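(* Let $F_2$ be the free group of rank $2$ and let $\operatorname{Aut}(F_2)$ be its automorphism group. Then the power orbit problem in $\operatorname{Aut}(F_2)$ is decidable, and the nonnegative power orbit problem in $\operatorname{Aut}(F_2)$ is decidable.
   Context: The power orbit problem in a group $G$ is the question: given $g, h \in G$, does there exist $k \in \mathbb{Z}$ such that $g^k = h$? The nonnegative power orbit problem in $G$ is the question: given $g, h \in G$, does there exist $k \in \mathbb{N}$ such that $g^k = h$? Here $\mathbb{N}$ includes $0$. Elements of $\operatorname{Aut}(F_2)$ are given as words in a fixed finite generating set (and their inverses), each generator being specified by the images of the two free generators of $F_2$. "Decidable" means that there is an algorithm (Turing machine) that halts on every input and answers correctly. *)

theory Defs
  imports "HOL-Algebra.Bij" "HOL-Algebra.Generated_Groups"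
begin

section \<open>Words and free groups\<close>

text \<open>The letter \<open>(x, True)\<close> stands for \<open>x\<close>, and \<open>(x, False)\<close> for its formal inverse.\<close>

type_synonym 'a letter = "'a \<times> bool"

definition inv_letter :: "'a letter \<Rightarrow> 'a letter" where
  "inv_letter l = (fst l, \<not> snd l)"

definition words :: "'a set \<Rightarrow> 'a letter list set" where
  "words X = lists (X \<times> UNIV)"

definition reduced :: "'a letter list \<Rightarrow> bool" where
  "reduced w \<longleftrightarrow> successively (\<lambda>l m. m \<noteq> inv_letter l) w"

fun cons_reduce :: "'a letter \<Rightarrow> 'a letter list \<Rightarrow> 'a letter list" where
  "cons_reduce l [] = [l]"
| "cons_reduce l (m # w) = (if m = inv_letter l then w else l # m # w)"

definition reduce :: "'a letter list \<Rightarrow> 'a letter list" where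
  "reduce w = foldr cons_reduce w []"

definition free_group :: "'a set \<Rightarrow> 'a letter list monoid" where
  "free_group X =
    \<lparr>carrier = {w \<in> words X. reduced w}, mult = (\<lambda>u v. reduce (u @ v)), one = []\<rparr>"

abbreviation F2 :: "nat letter list monoid" where
  "F2 \<equiv> free_group {0, 1}"

text \<open>The element of \<open>G\<close> spelled by a word when the letter \<open>(i, True)\<close> is read as \<open>f i\<close>.\<close>

definition letter_value :: "('g, 'b) monoid_scheme \<Rightarrow> ('a \<Rightarrow> 'g) \<Rightarrow> 'a letter \<Rightarrow> 'g" where
  "letter_value G f l = (if snd l then f (fst l) else inv\<^bsub>G\<^esub> (f (fst l)))"

definition word_value :: "('g, 'b) monoid_scheme \<Rightarrow> ('a \<Rightarrow> 'g) \<Rightarrow> 'a letter list \<Rightarrow> 'g" where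
  "word_value G f w = foldr (\<lambda>l g. letter_value G f l \<otimes>\<^bsub>G\<^esub> g) w \<one>\<^bsub>G\<^esub>"


subsection \<open>The free group is a group with the universal property\<close>

lemma inv_letter_inv_letter [simp]: "inv_letter (inv_letter l) = l"
  by (simp add: inv_letter_def)

lemma inv_letter_neq [simp]: "inv_letter l \<noteq> l" "l \<noteq> inv_letter l"
  by (auto simp: inv_letter_def prod_eq_iff)

lemma reduced_Nil [simp]: "reduced []"
  by (simp add: reduced_def)

lemma reduced_Cons:
  "reduced (l # w) \<longleftrightarrow> reduced w \<and> (w = [] \<or> hd w \<noteq> inv_letter l)"
  by (auto simp: reduced_def successively_Cons)

lemma reduced_cons_reduce: "reduced w \<Longrightarrow> reduced (cons_reduce l w)"
  by (cases w) (auto simp: reduced_Cons)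

lemma cons_reduce_cancel: "reduced w \<Longrightarrow> cons_reduce l (cons_reduce (inv_letter l) w) = w"
  by (cases w; cases "tl w") (auto simp: reduced_Cons)

lemma reduced_foldr: "reduced v \<Longrightarrow> reduced (foldr cons_reduce u v)"
  by (induction u) (auto simp: reduced_cons_reduce)

lemma reduced_reduce: "reduced (reduce w)"
  by (simp add: reduce_def reduced_foldr)

lemma reduce_reduced: "reduced w \<Longrightarrow> reduce w = w"
proof (induction w)
  case (Cons l w)
  then have "reduce (l # w) = cons_reduce l w"
    by (simp add: reduce_def reduced_Cons)
  with Cons.prems show ?case
    by (cases w) (auto simp: reduced_Cons)
qed (simp add: reduce_def)

lemma foldr_cons_reduce:
  "reduced v \<Longrightarrow> foldr cons_reduce (cons_reduce l w) v = cons_reduce l (foldr cons_reduce w v)"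
  by (cases w) (auto simp: cons_reduce_cancel reduced_foldr)

lemma foldr_reduce: "reduced v \<Longrightarrow> foldr cons_reduce (reduce u) v = foldr cons_reduce u v"
  by (induction u) (auto simp: reduce_def foldr_cons_reduce)

lemma reduce_append_left: "reduce (reduce u @ v) = reduce (u @ v)"
  using foldr_reduce[OF reduced_reduce, of u v] by (simp add: reduce_def)

lemma reduce_append_right: "reduce (u @ reduce v) = reduce (u @ v)"
  using reduce_reduced[OF reduced_reduce, of v] by (simp add: reduce_def)

lemma words_cons_reduce: "l \<in> X \<times> UNIV \<Longrightarrow> w \<in> words X \<Longrightarrow> cons_reduce l w \<in> words X"
  by (cases w) (auto simp: words_def)

lemma words_reduce: "w \<in> words X \<Longrightarrow> reduce w \<in> words X"
proof (induction w)
  case (Cons l w)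
  then have "reduce (l # w) = cons_reduce l (reduce w)" "l \<in> X \<times> UNIV" "reduce w \<in> words X"
    by (auto simp: reduce_def words_def)
  then show ?case by (simp add: words_cons_reduce)
qed (simp add: reduce_def)

lemma reduce_inverse: "reduce (rev (map inv_letter w) @ w) = []"
proof (induction w)
  case (Cons l w)
  have "foldr cons_reduce [inv_letter l, l] (reduce w) = reduce w"
    using cons_reduce_cancel[OF reduced_reduce, of "inv_letter l" w] by simp
  then have "foldr cons_reduce (inv_letter l # l # w) [] = foldr cons_reduce w []"
    by (simp add: reduce_def)
  with Cons show ?case by (simp add: reduce_def)
qed (simp add: reduce_def)

theorem group_free_group: "group (free_group X)"
proof (rule groupI)
  fix w assume "w \<in> carrier (free_group X)"
  then have w: "w \<in> words X" by (simp add: free_group_def)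
  let ?v = "reduce (rev (map inv_letter w))"
  have "rev (map inv_letter w) \<in> words X"
    using w by (auto simp: words_def inv_letter_def lists_eq_set)
  then have "?v \<in> carrier (free_group X)"
    by (simp add: free_group_def words_reduce reduced_reduce)
  moreover have "?v \<otimes>\<^bsub>free_group X\<^esub> w = \<one>\<^bsub>free_group X\<^esub>"
    by (simp add: free_group_def reduce_append_left reduce_inverse)
  ultimately show "\<exists>v\<in>carrier (free_group X). v \<otimes>\<^bsub>free_group X\<^esub> w = \<one>\<^bsub>free_group X\<^esub>"
    by blast
next
  fix u v assume "u \<in> carrier (free_group X)" "v \<in> carrier (free_group X)"
  then have "u @ v \<in> words X" by (auto simp: free_group_def words_def)
  then show "u \<otimes>\<^bsub>free_group X\<^esub> v \<in> carrier (free_group X)"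
    by (simp add: free_group_def words_reduce reduced_reduce)
qed (auto simp: free_group_def words_def reduce_append_left reduce_append_right reduce_reduced)

context group
begin

lemma letter_value_closed:
  "f \<in> X \<rightarrow> carrier G \<Longrightarrow> l \<in> X \<times> UNIV \<Longrightarrow> letter_value G f l \<in> carrier G"
  by (auto simp: letter_value_def)

lemma letter_value_inv_letter:
  "f \<in> X \<rightarrow> carrier G \<Longrightarrow> l \<in> X \<times> UNIV \<Longrightarrow> letter_value G f (inv_letter l) = inv (letter_value G f l)"
  by (auto simp: letter_value_def inv_letter_def Pi_iff)

lemma word_value_simps [simp]:
  "word_value G f [] = \<one>"
  "word_value G f (l # w) = letter_value G f l \<otimes> word_value G f w"
  by (simp_all add: word_value_def)

lemma word_value_closed:
  "f \<in> X \<rightarrow> carrier G \<Longrightarrow> w \<in> words X \<Longrightarrow> word_value G f w \<in> carrier G"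
  by (induction w) (auto simp: words_def intro!: letter_value_closed)

lemma word_value_append:
  assumes "f \<in> X \<rightarrow> carrier G" "u \<in> words X" "v \<in> words X"
  shows "word_value G f (u @ v) = word_value G f u \<otimes> word_value G f v"
  using assms(2)
proof (induction u)
  case Nil
  then show ?case using word_value_closed[OF assms(1,3)] by simp
next
  case (Cons l u)
  then have "l \<in> X \<times> UNIV" "u \<in> words X" by (auto simp: words_def)
  with Cons.IH show ?case
    using assms by (simp add: m_assoc letter_value_closed word_value_closed)
qed

lemma word_value_cons_reduce:
  assumes "f \<in> X \<rightarrow> carrier G" "l \<in> X \<times> UNIV" "w \<in> words X"
  shows "word_value G f (cons_reduce l w) = letter_value G f l \<otimes> word_value G f w"
proof (cases w)
  case (Cons m v)
  then have "v \<in> words X" using assms(3) by (simp add: words_def)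
  then show ?thesis
    using assms Cons letter_value_closed[OF assms(1,2)] word_value_closed[OF assms(1), of v]
    by (auto simp: letter_value_inv_letter m_assoc[symmetric])
qed simp

lemma word_value_reduce:
  assumes "f \<in> X \<rightarrow> carrier G" "w \<in> words X"
  shows "word_value G f (reduce w) = word_value G f w"
  using assms(2)
proof (induction w)
  case (Cons l w)
  then have "reduce (l # w) = cons_reduce l (reduce w)" "l \<in> X \<times> UNIV" "w \<in> words X"
    by (auto simp: reduce_def words_def)
  with Cons.IH show ?case
    using assms(1) by (simp add: word_value_cons_reduce words_reduce)
qed (simp add: reduce_def)

theorem free_group_hom:
  assumes "f \<in> X \<rightarrow> carrier G"
  shows "word_value G f \<in> hom (free_group X) G"
    and "\<And>x. x \<in> X \<Longrightarrow> word_value G f [(x, True)] = f x"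
proof -
  show "word_value G f \<in> hom (free_group X) G"
  proof (rule homI)
    fix u v assume "u \<in> carrier (free_group X)" "v \<in> carrier (free_group X)"
    then have *: "u \<in> words X" "v \<in> words X" by (auto simp: free_group_def)
    then have "u @ v \<in> words X" by (simp add: words_def)
    with * show "word_value G f (u \<otimes>\<^bsub>free_group X\<^esub> v) = word_value G f u \<otimes> word_value G f v"
      using assms by (simp add: free_group_def word_value_reduce word_value_append)
  qed (use word_value_closed[OF assms] in \<open>auto simp: free_group_def\<close>)
  show "word_value G f [(x, True)] = f x" if "x \<in> X" for x
    using assms that by (auto simp: letter_value_def Pi_iff)
qed

theorem free_group_hom_unique:
  assumes h: "h \<in> hom (free_group X) G" and "w \<in> carrier (free_group X)"
  shows "h w = word_value G (\<lambda>x. h [(x, True)]) w"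
  using assms(2)
proof (induction w)
  interpret F: group "free_group X" by (rule group_free_group)
  interpret H: group_hom "free_group X" G h
    using h by unfold_locales
  case Nil
  show ?case using H.hom_one by (simp add: free_group_def)
next
  interpret F: group "free_group X" by (rule group_free_group)
  interpret H: group_hom "free_group X" G h
    using h by unfold_locales
  case (Cons l w)
  obtain x b where l: "l = (x, b)" by force
  have in_F: "[(x, c)] \<in> carrier (free_group X)" for c
    using Cons.prems l by (auto simp: free_group_def words_def reduced_Cons)
  have w: "w \<in> carrier (free_group X)"
    using Cons.prems by (auto simp: free_group_def words_def reduced_Cons)
  have "[(x, False)] \<otimes>\<^bsub>free_group X\<^esub> [(x, True)] = \<one>\<^bsub>free_group X\<^esub>"
    by (simp add: free_group_def reduce_def inv_letter_def)
  then have "inv\<^bsub>free_group X\<^esub> [(x, True)] = [(x, False)]"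
    using in_F F.inv_equality by blast
  then have "h [(x, False)] = inv (h [(x, True)])"
    using H.hom_inv[OF in_F[of True]] by simp
  then have "h [l] = letter_value G (\<lambda>x. h [(x, True)]) l"
    by (cases b) (simp_all add: l letter_value_def)
  moreover have "l # w = [l] \<otimes>\<^bsub>free_group X\<^esub> w"
    using Cons.prems by (simp add: free_group_def reduce_reduced)
  ultimately show ?case
    using H.hom_mult[OF in_F[of b] w] Cons.IH[OF w] l by (metis word_value_simps(2))
qed

end


section \<open>Turing machines and decidable languages\<close>

text \<open>
  Deterministic Turing machines with finitely many two-way infinite tapes. A tape is its contents
  together with the position of the head.
\<close>

type_synonym 's tape = "(int \<Rightarrow> 's) \<times> int"

datatype move = Move_Left | Stay | Move_Right

record 's tm =
  tm_tapes :: nat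
  tm_states :: "nat set"
  tm_symbols :: "'s set"
  tm_blank :: 's
  tm_start :: nat
  tm_accept :: nat
  tm_reject :: nat
  tm_delta :: "nat \<Rightarrow> 's list \<Rightarrow> nat \<times> ('s \<times> move) list"

text \<open>
  The tape alphabet contains a copy \<open>Inl ` \<Sigma>\<close> of the input alphabet; the summand \<^typ>\<open>nat\<close>
  leaves room for the blank and for any number of auxiliary symbols.
\<close>

definition turing_machine :: "'a set \<Rightarrow> ('a + nat) tm \<Rightarrow> bool" where
  "turing_machine \<Sigma> M \<longleftrightarrow>
     tm_tapes M > 0 \<and>
     finite (tm_states M) \<and> {tm_start M, tm_accept M, tm_reject M} \<subseteq> tm_states M \<and>
     tm_accept M \<noteq> tm_reject M \<and>
     finite (tm_symbols M) \<and> Inl ` \<Sigma> \<subseteq> tm_symbols M \<and> tm_blank M \<in> tm_symbols M - Inl ` \<Sigma> \<and>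
     (\<forall>q\<in>tm_states M. \<forall>ss. length ss = tm_tapes M \<and> set ss \<subseteq> tm_symbols M \<longrightarrow>
        (case tm_delta M q ss of (q', as) \<Rightarrow>
           q' \<in> tm_states M \<and> length as = tm_tapes M \<and> fst ` set as \<subseteq> tm_symbols M))"

definition tape_read :: "'s tape \<Rightarrow> 's" where
  "tape_read t = fst t (snd t)"

definition move_offset :: "move \<Rightarrow> int" where
  "move_offset d = (case d of Move_Left \<Rightarrow> -1 | Stay \<Rightarrow> 0 | Move_Right \<Rightarrow> 1)"

definition tape_act :: "'s \<times> move \<Rightarrow> 's tape \<Rightarrow> 's tape" where
  "tape_act a t = ((fst t)(snd t := fst a), snd t + move_offset (snd a))"

definition tm_step :: "'s tm \<Rightarrow> nat \<times> 's tape list \<Rightarrow> nat \<times> 's tape list" where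
  "tm_step M c =
     (let (q, ts) = c in
      if q \<in> {tm_accept M, tm_reject M} then c
      else let (q', as) = tm_delta M q (map tape_read ts) in (q', map2 tape_act as ts))"

definition input_tape :: "'s \<Rightarrow> 's list \<Rightarrow> 's tape" where
  "input_tape b w = ((\<lambda>i. if 0 \<le> i \<and> i < int (length w) then w ! nat i else b), 0)"

text \<open>The input is written on the first tape; all other tapes are blank.\<close>

definition tm_init :: "('a + nat) tm \<Rightarrow> 'a list \<Rightarrow> nat \<times> ('a + nat) tape list" where
  "tm_init M w =
     (tm_start M,
      input_tape (tm_blank M) (map Inl w) # replicate (tm_tapes M - 1) (input_tape (tm_blank M) []))"

definition tm_halts_in :: "('a + nat) tm \<Rightarrow> 'a list \<Rightarrow> nat \<Rightarrow> bool" where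
  "tm_halts_in M w q \<longleftrightarrow> (\<exists>n. fst ((tm_step M ^^ n) (tm_init M w)) = q)"

definition tm_accepts :: "('a + nat) tm \<Rightarrow> 'a list \<Rightarrow> bool" where
  "tm_accepts M w \<longleftrightarrow> tm_halts_in M w (tm_accept M)"

definition tm_rejects :: "('a + nat) tm \<Rightarrow> 'a list \<Rightarrow> bool" where
  "tm_rejects M w \<longleftrightarrow> tm_halts_in M w (tm_reject M)"

text \<open>The machine has to halt on every word over the alphabet \<open>\<Sigma>\<close>.\<close>

definition decidable_language :: "'a set \<Rightarrow> 'a list set \<Rightarrow> bool" where
  "decidable_language \<Sigma> L \<longleftrightarrow>
     L \<subseteq> lists \<Sigma> \<and>
     (\<exists>M. turing_machine \<Sigma> M \<and>
        (\<forall>w\<in>lists \<Sigma>. (w \<in> L \<longrightarrow> tm_accepts M w) \<and> (w \<notin> L \<longrightarrow> tm_rejects M w)))"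


section \<open>Power orbit problems\<close>

text \<open>
  A finite generating sequence \<open>gs\<close> of \<open>G\<close> is fixed, and the input alphabet consists of the letters
  \<open>(i, True)\<close> for \<open>gs ! i\<close>, \<open>(i, False)\<close> for its inverse, and a separator \<^term>\<open>None\<close>. The instance
  given by two words \<open>u\<close> and \<open>v\<close> is the string consisting of \<open>u\<close>, the separator and \<open>v\<close>.
\<close>

definition pair_alphabet :: "'g list \<Rightarrow> nat letter option set" where
  "pair_alphabet gs = insert None (Some ` ({..<length gs} \<times> UNIV))"

definition encode_pair :: "nat letter list \<Rightarrow> nat letter list \<Rightarrow> nat letter option list" where
  "encode_pair u v = map Some u @ [None] @ map Some v"

definition power_orbit_language ::
  "('g, 'b) monoid_scheme \<Rightarrow> 'g list \<Rightarrow> nat letter option list set" where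
  "power_orbit_language G gs =
     {encode_pair u v | u v. u \<in> words {..<length gs} \<and> v \<in> words {..<length gs} \<and>
        (\<exists>k::int. word_value G ((!) gs) u [^]\<^bsub>G\<^esub> k = word_value G ((!) gs) v)}"

definition nonneg_power_orbit_language ::
  "('g, 'b) monoid_scheme \<Rightarrow> 'g list \<Rightarrow> nat letter option list set" where
  "nonneg_power_orbit_language G gs =
     {encode_pair u v | u v. u \<in> words {..<length gs} \<and> v \<in> words {..<length gs} \<and>
        (\<exists>k::nat. word_value G ((!) gs) u [^]\<^bsub>G\<^esub> k = word_value G ((!) gs) v)}"

definition power_orbit_decidable :: "('g, 'b) monoid_scheme \<Rightarrow> 'g list \<Rightarrow> bool" where
  "power_orbit_decidable G gs \<longleftrightarrow>
     decidable_language (pair_alphabet gs) (power_orbit_language G gs)"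

definition nonneg_power_orbit_decidable :: "('g, 'b) monoid_scheme \<Rightarrow> 'g list \<Rightarrow> bool" where
  "nonneg_power_orbit_decidable G gs \<longleftrightarrow>
     decidable_language (pair_alphabet gs) (nonneg_power_orbit_language G gs)"

end

theory Submission
  imports Defs "HOL-Library.Countable"
begin

text \<open>
  If \<open>g\<^sup>k = h\<close> has a solution, it has one with \<open>\<bar>k\<bar>\<close> below a computable bound, and a bounded search
  decides the problem. If the action of \<open>g\<close> on the abelianization has infinite order, some
  off-diagonal entry of its powers grows at least linearly, while the entry for \<open>h\<close> is bounded by word
  lengths. Otherwise \<open>\<psi> = g\<^sup>1\<^sup>2\<close> acts trivially on the abelianization. If \<open>\<psi>\<close> is not the identity, let \<open>n\<close>
  be the lowest degree in which it changes a coefficient of the Magnus expansion of a generator; then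
  the coefficients of \<open>\<psi>\<^sup>j w\<close> in degree \<open>n\<close> are affine in \<open>j\<close>, whereas all coefficients of a word of
  length \<open>l\<close> are at most \<open>2\<^sup>l\<close>. If \<open>\<psi>\<close> is the identity, \<open>k\<close> may be reduced modulo 12.
\<close>

section \<open>Stack programs and Turing machines\<close>

datatype 's com =
    Skip
  | Push nat 's
  | Seq "'s com" "'s com" (infixr ";;" 60)
  | Case nat "'s option \<Rightarrow> 's com"
  | Loop nat "'s \<Rightarrow> 's com"

primrec exec :: "'s com \<Rightarrow> (nat \<Rightarrow> 's list) \<Rightarrow> nat \<Rightarrow> 's list" where
  "exec Skip \<sigma> = \<sigma>"
| "exec (Push r s) \<sigma> = \<sigma>(r := s # \<sigma> r)"
| "exec (Seq c d) \<sigma> = exec d (exec c \<sigma>)"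
| "exec (Case r f) \<sigma> =
     (case \<sigma> r of [] \<Rightarrow> exec (f None) \<sigma> | s # xs \<Rightarrow> exec (f (Some s)) (\<sigma>(r := xs)))"
| "exec (Loop r f) \<sigma> = fold (\<lambda>s. exec (f s)) (\<sigma> r) (\<sigma>(r := []))"

primrec untouched :: "nat \<Rightarrow> 's com \<Rightarrow> bool" where
  "untouched q Skip = True"
| "untouched q (Push r s) = (q \<noteq> r)"
| "untouched q (Seq c d) = (untouched q c \<and> untouched q d)"
| "untouched q (Case r f) = (q \<noteq> r \<and> (\<forall>x. untouched q (f x)))"
| "untouched q (Loop r f) = (q \<noteq> r \<and> (\<forall>s. untouched q (f s)))"

primrec wf_com :: "nat \<Rightarrow> 's set \<Rightarrow> 's com \<Rightarrow> bool" where
  "wf_com R S Skip = True"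
| "wf_com R S (Push r s) = (r < R \<and> s \<in> S)"
| "wf_com R S (Seq c d) = (wf_com R S c \<and> wf_com R S d)"
| "wf_com R S (Case r f) = (r < R \<and> (\<forall>x\<in>insert None (Some ` S). wf_com R S (f x)))"
| "wf_com R S (Loop r f) = (r < R \<and> (\<forall>s\<in>S. wf_com R S (f s) \<and> untouched r (f s)))"

lemma exec_untouched: "untouched q c \<Longrightarrow> exec c (\<sigma>(q := xs)) = (exec c \<sigma>)(q := xs)"
proof (induction c arbitrary: \<sigma>)
  case (Case r f)
  then have "exec (f x) (\<sigma>'(q := xs)) = (exec (f x) \<sigma>')(q := xs)" for x \<sigma>'
    by (auto simp del: fun_upd_apply)
  then show ?case
    using Case.prems by (auto simp del: fun_upd_apply simp: fun_upd_twist[of q r] fun_upd_other split: list.split)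
next
  case (Loop r f)
  have "fold (\<lambda>s. exec (f s)) ys (\<sigma>(q := xs)) = (fold (\<lambda>s. exec (f s)) ys \<sigma>)(q := xs)" for ys \<sigma>
    using Loop by (induction ys arbitrary: \<sigma>) auto
  from this[of "\<sigma> r" "\<sigma>(r := [])"] Loop.prems show ?case
    by (simp del: fun_upd_apply add: fun_upd_twist[of q r] fun_upd_other)
qed (auto simp: fun_upd_twist)

lemma exec_Loop_Cons:
  assumes "untouched r (f s)" "\<sigma> r = s # xs"
  shows "exec (Loop r f) \<sigma> = exec (Loop r f) (exec (f s) (\<sigma>(r := xs)))"
proof -
  define \<tau> where "\<tau> = exec (f s) (\<sigma>(r := []))"
  have "exec (f s) (\<sigma>(r := xs)) = \<tau>(r := xs)" "\<tau>(r := []) = \<tau>"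
    using exec_untouched[OF assms(1), of "\<sigma>(r := [])" xs]
      exec_untouched[OF assms(1), of "\<sigma>(r := [])" "[]"] by (simp_all add: \<tau>_def)
  with assms show ?thesis by (simp add: \<tau>_def)
qed

text \<open>
  A program is run by a machine whose states are the lists of commands that remain to be executed;
  \<open>conts S c K\<close> collects those that occur while \<open>c\<close> is executed in front of \<open>K\<close>.
  A push takes two steps, and the states \<^term>\<open>Write K\<close> stand between them.
\<close>

datatype 's ctl = Run "'s com list" | Write "'s com list" | Halt bool

primrec conts :: "'s set \<Rightarrow> 's com \<Rightarrow> 's com list \<Rightarrow> 's com list set" where
  "conts S Skip K = {Skip # K}"
| "conts S (Push r s) K = {Push r s # K}"
| "conts S (Seq c d) K = insert (Seq c d # K) (conts S c (d # K) \<union> conts S d K)"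
| "conts S (Case r f) K = insert (Case r f # K) (\<Union>x\<in>insert None (Some ` S). conts S (f x) K)"
| "conts S (Loop r f) K = insert (Loop r f # K) (\<Union>s\<in>S. conts S (f s) (Loop r f # K))"

definition stay :: "'s list \<Rightarrow> ('s \<times> move) list" where
  "stay ss = map (\<lambda>s. (s, Stay)) ss"

fun ctl_step :: "'s \<Rightarrow> nat \<Rightarrow> 's ctl \<Rightarrow> 's list \<Rightarrow> 's ctl \<times> ('s \<times> move) list" where
  "ctl_step b out (Run []) ss = (Halt (ss ! out \<noteq> b), stay ss)"
| "ctl_step b out (Run (Skip # K)) ss = (Run K, stay ss)"
| "ctl_step b out (Run (Push r s # K)) ss =
     (Write (Push r s # K), (stay ss)[r := (ss ! r, Move_Left)])"
| "ctl_step b out (Write (Push r s # K)) ss = (Run K, (stay ss)[r := (s, Stay)])"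
| "ctl_step b out (Run (Seq c d # K)) ss = (Run (c # d # K), stay ss)"
| "ctl_step b out (Run (Case r f # K)) ss =
     (if ss ! r = b then (Run (f None # K), stay ss)
      else (Run (f (Some (ss ! r)) # K), (stay ss)[r := (ss ! r, Move_Right)]))"
| "ctl_step b out (Run (Loop r f # K)) ss =
     (if ss ! r = b then (Run K, stay ss)
      else (Run (f (ss ! r) # Loop r f # K), (stay ss)[r := (ss ! r, Move_Right)]))"
| "ctl_step b out q ss = (q, stay ss)"

lemma finite_conts: "finite S \<Longrightarrow> finite (conts S c K)"
  by (induction c arbitrary: K) auto

lemma Cons_in_conts: "c # K \<in> conts S c K"
  by (cases c) auto

lemma wf_conts:
  "L \<in> conts S c K \<Longrightarrow> wf_com R S c \<Longrightarrow> list_all (wf_com R S) K \<Longrightarrow> list_all (wf_com R S) L"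
proof (induction c arbitrary: K)
  case (Case r f)
  show ?case
  proof (cases "L = Case r f # K")
    case False
    then obtain x where x: "x \<in> insert None (Some ` S)" "L \<in> conts S (f x) K"
      using Case.prems(1) by auto
    show ?thesis
      by (rule Case.IH[OF _ x(2)]) (use Case.prems x(1) in auto)
  qed (use Case.prems in simp)
next
  case (Loop r f)
  show ?case
  proof (cases "L = Loop r f # K")
    case False
    then obtain s where s: "s \<in> S" "L \<in> conts S (f s) (Loop r f # K)"
      using Loop.prems(1) by auto
    show ?thesis
      by (rule Loop.IH[OF _ s(2)]) (use Loop.prems s in auto)
  qed (use Loop.prems in simp)
next
  case (Seq c d)
  from Seq.prems(1) consider "L = Seq c d # K" | "L \<in> conts S c (d # K)" | "L \<in> conts S d K"
    by auto
  then show ?case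
  proof cases
    case 2
    then show ?thesis by (rule Seq.IH(1)) (use Seq.prems in auto)
  next
    case 3
    then show ?thesis by (rule Seq.IH(2)) (use Seq.prems in auto)
  qed (use Seq.prems in simp)
qed (auto simp: list_all_iff)

lemma conts_step:
  assumes "L \<in> conts S c K" "wf_com R S c" "set ss \<subseteq> insert b S" "length ss = R"
    and "q \<in> {Run L, Write L}"
  shows "fst (ctl_step b out q ss) \<in> (Run ` insert K (conts S c K)) \<union> (Write ` conts S c K)"
  using assms(1,2,5)
proof (induction c arbitrary: K)
  case (Seq c d)
  from Seq.prems(1) consider "L = Seq c d # K" | "L \<in> conts S c (d # K)" | "L \<in> conts S d K"
    by auto
  then show ?case
  proof cases
    case 1
    then show ?thesis using Seq.prems(3) Cons_in_conts[of c "d # K" S] by auto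
  next
    case 2
    have "fst (ctl_step b out q ss) \<in> (Run ` insert (d # K) (conts S c (d # K))) \<union> (Write ` conts S c (d # K))"
      using Seq.IH(1)[OF 2] Seq.prems by auto
    then show ?thesis using Cons_in_conts[of d K S] by auto
  next
    case 3
    have "fst (ctl_step b out q ss) \<in> (Run ` insert K (conts S d K)) \<union> (Write ` conts S d K)"
      using Seq.IH(2)[OF 3] Seq.prems by auto
    then show ?thesis by auto
  qed
next
  case (Case r f)
  have *: "ss ! r \<in> insert b S" using Case assms(3,4) by (auto simp: subset_eq)
  show ?case
  proof (cases "L = Case r f # K")
    case True
    have "f (Some (ss ! r)) # K \<in> (\<Union>x\<in>S. conts S (f (Some x)) K)" if "ss ! r \<noteq> b"
      using * that Cons_in_conts by fastforce
    with True show ?thesis using Case.prems(3) Cons_in_conts[of "f None" K S] by auto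
  next
    case False
    then obtain x where x: "x \<in> insert None (Some ` S)" "L \<in> conts S (f x) K"
      using Case.prems(1) by auto
    then have "fst (ctl_step b out q ss) \<in> (Run ` insert K (conts S (f x) K)) \<union> (Write ` conts S (f x) K)"
      using Case.prems by (intro Case.IH) auto
    then show ?thesis using x by auto
  qed
next
  case (Loop r f)
  have *: "ss ! r \<in> insert b S" using Loop assms(3,4) by (auto simp: subset_eq)
  show ?case
  proof (cases "L = Loop r f # K")
    case True
    have "f (ss ! r) # Loop r f # K \<in> (\<Union>x\<in>S. conts S (f x) (Loop r f # K))" if "ss ! r \<noteq> b"
      using * that Cons_in_conts by fastforce
    with True show ?thesis using Loop.prems(3) by auto
  next
    case False
    then obtain x where x: "x \<in> S" "L \<in> conts S (f x) (Loop r f # K)"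
      using Loop.prems(1) by auto
    then have "fst (ctl_step b out q ss) \<in>
        (Run ` insert (Loop r f # K) (conts S (f x) (Loop r f # K))) \<union> (Write ` conts S (f x) (Loop r f # K))"
      using Loop.prems by (intro Loop.IH) auto
    then show ?thesis using x by auto
  qed
qed auto

lemma ctl_step_actions:
  assumes "q \<in> {Run L, Write L}" "list_all (wf_com R S) L" "set ss \<subseteq> insert b S" "length ss = R"
    and "snd (ctl_step b out q ss) = as"
  shows "length as = R \<and> fst ` set as \<subseteq> insert b S"
proof -
  have stay: "length (stay ss) = R" "fst ` set (stay ss) \<subseteq> insert b S"
    using assms(3,4) by (auto simp: stay_def)
  have upd: "fst ` set ((stay ss)[r := (s, m)]) \<subseteq> insert b S" if "s \<in> insert b S" for r s m
    using stay(2) that set_update_subset_insert[of "stay ss" r "(s, m)"] by fastforce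
  have nth: "ss ! r \<in> insert b S" if "r < R" for r
    using that assms(3,4) by (auto simp: subset_eq)
  show ?thesis
  proof (cases L)
    case Nil
    with assms(1,5) have "as = stay ss" by auto
    with stay show ?thesis by simp
  next
    case (Cons c K)
    then have wf: "wf_com R S c" using assms(2) by simp
    have "as = stay ss \<or> (\<exists>r s m. as = (stay ss)[r := (s, m)] \<and> s \<in> insert b S)"
    proof (cases c)
      case (Push r s)
      then have "as = (stay ss)[r := (ss ! r, Move_Left)] \<or> as = (stay ss)[r := (s, Stay)]"
        using Cons assms(1,5) by auto
      moreover have "ss ! r \<in> insert b S" "s \<in> insert b S" using Push wf nth[of r] by simp_all
      ultimately show ?thesis by blast
    next
      case (Case r f)
      then have "as = stay ss \<or> as = (stay ss)[r := (ss ! r, Move_Right)]"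
        using Cons assms(1,5) by auto
      moreover have "ss ! r \<in> insert b S" using Case wf nth[of r] by simp
      ultimately show ?thesis by blast
    next
      case (Loop r f)
      then have "as = stay ss \<or> as = (stay ss)[r := (ss ! r, Move_Right)]"
        using Cons assms(1,5) by auto
      moreover have "ss ! r \<in> insert b S" using Loop wf nth[of r] by simp
      ultimately show ?thesis by blast
    qed (use Cons assms(1,5) in auto)
    then show ?thesis using stay upd by (metis length_list_update)
  qed
qed

primrec on_tape :: "'s \<Rightarrow> (int \<Rightarrow> 's) \<Rightarrow> int \<Rightarrow> 's list \<Rightarrow> bool" where
  "on_tape b f p [] = (f p = b)"
| "on_tape b f p (x # xs) = (f p = x \<and> on_tape b f (p + 1) xs)"

lemma on_tape_cong: "(\<And>i. i \<ge> p \<Longrightarrow> f i = g i) \<Longrightarrow> on_tape b f p xs = on_tape b g p xs"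
  by (induction xs arbitrary: p) auto

lemma on_tape_input: "on_tape b (fst (input_tape b xs)) (snd (input_tape b xs)) xs"
proof -
  have "on_tape b (fst (input_tape b xs)) (int k) (drop k xs)" if "k \<le> length xs" for k
    using that
  proof (induction k rule: inc_induct)
    case (step k)
    then have "drop k xs = xs ! k # drop (Suc k) xs" by (simp add: Cons_nth_drop_Suc)
    with step show ?case by (simp add: input_tape_def add.commute)
  qed (simp add: input_tape_def)
  from this[of 0] show ?thesis by (simp add: input_tape_def)
qed

lemma map2_tape_act_stay: "map2 tape_act (stay (map tape_read ts)) ts = ts"
  by (rule nth_equalityI)
    (auto simp: stay_def tape_act_def tape_read_def move_offset_def prod_eq_iff)

lemma map2_tape_act_update:
  "map2 tape_act ((stay (map tape_read ts))[r := a]) ts = ts[r := tape_act a (ts ! r)]"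
proof (rule nth_equalityI)
  fix i assume "i < length (map2 tape_act ((stay (map tape_read ts))[r := a]) ts)"
  then show "map2 tape_act ((stay (map tape_read ts))[r := a]) ts ! i = ts[r := tape_act a (ts ! r)] ! i"
    by (cases "i = r")
      (auto simp: stay_def tape_act_def tape_read_def move_offset_def prod_eq_iff)
qed (simp add: stay_def)

definition tapes_hold :: "'s \<Rightarrow> 's set \<Rightarrow> nat \<Rightarrow> 's tape list \<Rightarrow> (nat \<Rightarrow> 's list) \<Rightarrow> bool" where
  "tapes_hold b S R ts \<sigma> \<longleftrightarrow> length ts = R \<and>
     (\<forall>r<R. set (\<sigma> r) \<subseteq> S \<and> on_tape b (fst (ts ! r)) (snd (ts ! r)) (\<sigma> r))"

definition reaches :: "'s tm \<Rightarrow> nat \<times> 's tape list \<Rightarrow> nat \<times> 's tape list \<Rightarrow> bool" where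
  "reaches M c d \<longleftrightarrow> (\<exists>n. (tm_step M ^^ n) c = d)"

lemma reaches_refl: "reaches M c c"
  unfolding reaches_def by (rule exI[of _ 0]) simp

lemma reaches_step: "reaches M (tm_step M c) d \<Longrightarrow> reaches M c d"
  unfolding reaches_def by (metis funpow_simps_right(2) o_apply)

lemma reaches_trans: "reaches M c d \<Longrightarrow> reaches M d e \<Longrightarrow> reaches M c e"
  unfolding reaches_def using funpow_add[of _ _ "tm_step M"] by (metis o_apply)

lemma reaches_1: "tm_step M c = d \<Longrightarrow> reaches M c d"
  using reaches_step reaches_refl by metis

lemma tapes_hold_read:
  assumes "tapes_hold b S R ts \<sigma>" "r < R" "b \<notin> S"
  shows "tape_read (ts ! r) = (case \<sigma> r of [] \<Rightarrow> b | s # xs \<Rightarrow> s)"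
    and "tape_read (ts ! r) = b \<longleftrightarrow> \<sigma> r = []"
proof -
  have *: "set (\<sigma> r) \<subseteq> S" "on_tape b (fst (ts ! r)) (snd (ts ! r)) (\<sigma> r)"
    using assms by (auto simp: tapes_hold_def)
  then show "tape_read (ts ! r) = (case \<sigma> r of [] \<Rightarrow> b | s # xs \<Rightarrow> s)"
    by (auto simp: tape_read_def split: list.split)
  with * assms(3) show "tape_read (ts ! r) = b \<longleftrightarrow> \<sigma> r = []"
    by (auto split: list.splits)
qed

lemma tapes_hold_pop:
  assumes "tapes_hold b S R ts \<sigma>" "r < R" "\<sigma> r = s # xs"
  shows "tapes_hold b S R (ts[r := tape_act (tape_read (ts ! r), Move_Right) (ts ! r)]) (\<sigma>(r := xs))"
  unfolding tapes_hold_def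
proof (intro conjI allI impI)
  fix q assume "q < R"
  with assms have "set (\<sigma> q) \<subseteq> S" "on_tape b (fst (ts ! q)) (snd (ts ! q)) (\<sigma> q)" "length ts = R"
    by (auto simp: tapes_hold_def)
  with assms(2,3)
  show "set ((\<sigma>(r := xs)) q) \<subseteq> S"
    and "on_tape b (fst (ts[r := tape_act (tape_read (ts ! r), Move_Right) (ts ! r)] ! q))
       (snd (ts[r := tape_act (tape_read (ts ! r), Move_Right) (ts ! r)] ! q)) ((\<sigma>(r := xs)) q)"
    by (cases "q = r"; auto simp: tape_act_def tape_read_def move_offset_def)+
qed (use assms in \<open>simp add: tapes_hold_def\<close>)

lemma tapes_hold_push:
  assumes "tapes_hold b S R ts \<sigma>" "r < R" "s \<in> S"
  defines "t \<equiv> tape_act (tape_read (ts ! r), Move_Left) (ts ! r)"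
  shows "tapes_hold b S R (ts[r := tape_act (s, Stay) t]) (\<sigma>(r := s # \<sigma> r))"
proof -
  let ?f = "fst (ts ! r)" and ?p = "snd (ts ! r)"
  have "on_tape b (?f(?p - 1 := s)) ?p (\<sigma> r) = on_tape b ?f ?p (\<sigma> r)"
    by (rule on_tape_cong) auto
  with assms show ?thesis
    by (auto simp: tapes_hold_def t_def tape_act_def tape_read_def move_offset_def nth_list_update)
qed

locale ctl_tm =
  fixes M :: "'s tm" and e :: "'s ctl \<Rightarrow> nat" and Q :: "'s ctl set"
    and b :: 's and S :: "'s set" and R out :: nat
  assumes inj: "inj_on e Q" and halts: "range Halt \<subseteq> Q" and b: "b \<notin> S"
    and closed: "\<And>q ss. q \<in> Q \<Longrightarrow> length ss = R \<Longrightarrow> set ss \<subseteq> insert b S \<Longrightarrow>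
                   fst (ctl_step b out q ss) \<in> Q"
    and accept: "tm_accept M = e (Halt True)" and reject: "tm_reject M = e (Halt False)"
    and delta: "\<And>q ss. q \<in> Q \<Longrightarrow>
                  tm_delta M (e q) ss = map_prod e id (ctl_step b out q ss)"
begin

lemma tm_step_ctl:
  assumes "q \<in> Q" "\<forall>h. q \<noteq> Halt h"
  shows "tm_step M (e q, ts) =
    (case ctl_step b out q (map tape_read ts) of (q', as) \<Rightarrow> (e q', map2 tape_act as ts))"
proof -
  have "e q \<noteq> e (Halt h)" for h
    using assms inj halts by (metis inj_onD range_subsetD)
  then show ?thesis
    by (simp add: tm_step_def accept reject delta[OF assms(1)] split: prod.split)
qed

lemma closed_tapes:
  assumes "q \<in> Q" "tapes_hold b S R ts \<sigma>" "ctl_step b out q (map tape_read ts) = (q', as)"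
  shows "q' \<in> Q"
proof -
  have "tape_read t \<in> insert b S" if t: "t \<in> set ts" for t
  proof -
    obtain r where "r < R" "t = ts ! r"
      using t assms(2) by (auto simp: in_set_conv_nth tapes_hold_def)
    then show ?thesis
      using tapes_hold_read(1)[OF assms(2) _ b, of r] assms(2)
      by (auto simp: tapes_hold_def split: list.split)
  qed
  then have "tape_read ` set ts \<subseteq> insert b S" by blast
  then show ?thesis
    using closed[OF assms(1), of "map tape_read ts"] assms(2,3) by (simp add: tapes_hold_def)
qed

lemma run_com:
  assumes "wf_com R S c" "Run (c # K) \<in> Q" "tapes_hold b S R ts \<sigma>"
  shows "\<exists>ts'. reaches M (e (Run (c # K)), ts) (e (Run K), ts') \<and> Run K \<in> Q \<and>
    tapes_hold b S R ts' (exec c \<sigma>)"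
  using assms
proof (induction c arbitrary: K ts \<sigma>)
  case Skip
  have "reaches M (e (Run (Skip # K)), ts) (e (Run K), ts)"
    by (rule reaches_1) (use tm_step_ctl[OF Skip.prems(2)] in \<open>simp add: map2_tape_act_stay\<close>)
  then show ?case using closed_tapes[OF Skip.prems(2,3)] Skip.prems by auto
next
  case (Push r s)
  let ?t = "ts[r := tape_act (tape_read (ts ! r), Move_Left) (ts ! r)]"
  let ?u = "ts[r := tape_act (s, Stay) (?t ! r)]"
  have r: "r < R" "s \<in> S" "length ts = R" using Push by (auto simp: tapes_hold_def)
  have W: "Write (Push r s # K) \<in> Q"
    using closed_tapes[OF Push.prems(2,3)] by simp
  have "tm_step M (e (Run (Push r s # K)), ts) = (e (Write (Push r s # K)), ?t)"
    using tm_step_ctl[OF Push.prems(2), of ts] r by (auto simp: map2_tape_act_update)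
  moreover have "tm_step M (e (Write (Push r s # K)), ?t) = (e (Run K), ?u)"
    using tm_step_ctl[OF W, of ?t] r by (auto simp: map2_tape_act_update)
  ultimately have "reaches M (e (Run (Push r s # K)), ts) (e (Run K), ?u)"
    by (metis reaches_1 reaches_trans)
  moreover have "tapes_hold b S R ?u (exec (Push r s) \<sigma>)"
    using tapes_hold_push[OF Push.prems(3) r(1,2)] r by simp
  moreover have "Run K \<in> Q"
    using closed_tapes[OF W Push.prems(3)] by simp
  ultimately show ?case by blast
next
  case (Seq c d)
  have c: "Run (c # d # K) \<in> Q"
    using closed_tapes[OF Seq.prems(2,3)] by simp
  have 1: "reaches M (e (Run (Seq c d # K)), ts) (e (Run (c # d # K)), ts)"
    by (rule reaches_1) (use tm_step_ctl[OF Seq.prems(2)] in \<open>simp add: map2_tape_act_stay\<close>)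
  obtain ts' where 2: "reaches M (e (Run (c # d # K)), ts) (e (Run (d # K)), ts')"
    and d: "Run (d # K) \<in> Q" and ts': "tapes_hold b S R ts' (exec c \<sigma>)"
    using Seq.IH(1)[OF _ c Seq.prems(3)] Seq.prems(1) by auto
  obtain ts'' where 3: "reaches M (e (Run (d # K)), ts') (e (Run K), ts'')"
    and "Run K \<in> Q" "tapes_hold b S R ts'' (exec d (exec c \<sigma>))"
    using Seq.IH(2)[OF _ d ts'] Seq.prems(1) by auto
  then show ?case using reaches_trans[OF 1 reaches_trans[OF 2 3]] by auto
next
  case (Case r f)
  have r: "r < R" "length ts = R" "set (\<sigma> r) \<subseteq> S" using Case.prems by (auto simp: tapes_hold_def)
  define x where "x = (case \<sigma> r of [] \<Rightarrow> None | s # xs \<Rightarrow> Some s)"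
  have x: "x \<in> insert None (Some ` S)" using r(3) by (auto simp: x_def split: list.split)
  have "\<exists>ts1. reaches M (e (Run (Case r f # K)), ts) (e (Run (f x # K)), ts1) \<and> Run (f x # K) \<in> Q \<and>
      tapes_hold b S R ts1 (\<sigma>(r := tl (\<sigma> r)))"
  proof (cases "\<sigma> r")
    case Nil
    then have *: "tape_read (ts ! r) = b" using tapes_hold_read(2)[OF Case.prems(3) r(1) b] by simp
    have "reaches M (e (Run (Case r f # K)), ts) (e (Run (f x # K)), ts)"
      by (rule reaches_1)
        (use tm_step_ctl[OF Case.prems(2)] * r Nil in \<open>simp add: map2_tape_act_stay x_def\<close>)
    moreover have "Run (f x # K) \<in> Q"
      using closed_tapes[OF Case.prems(2,3)] * r Nil by (simp add: x_def)
    moreover have "\<sigma>(r := tl (\<sigma> r)) = \<sigma>" using Nil by (simp add: fun_eq_iff)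
    ultimately show ?thesis using Case.prems(3) by auto
  next
    case (Cons s xs)
    then have *: "tape_read (ts ! r) = s" "s \<noteq> b"
      using tapes_hold_read[OF Case.prems(3) r(1) b] by auto
    have "reaches M (e (Run (Case r f # K)), ts)
        (e (Run (f x # K)), ts[r := tape_act (tape_read (ts ! r), Move_Right) (ts ! r)])"
      by (rule reaches_1)
        (use tm_step_ctl[OF Case.prems(2)] * r Cons in \<open>simp add: map2_tape_act_update x_def\<close>)
    moreover have "Run (f x # K) \<in> Q"
      using closed_tapes[OF Case.prems(2,3)] * r Cons by (simp add: x_def)
    ultimately show ?thesis using tapes_hold_pop[OF Case.prems(3) r(1) Cons] Cons by auto
  qed
  then obtain ts1 where 1: "reaches M (e (Run (Case r f # K)), ts) (e (Run (f x # K)), ts1)"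
    "Run (f x # K) \<in> Q" "tapes_hold b S R ts1 (\<sigma>(r := tl (\<sigma> r)))" by blast
  have "exec (Case r f) \<sigma> = exec (f x) (\<sigma>(r := tl (\<sigma> r)))"
    by (cases "\<sigma> r") (auto simp: x_def fun_upd_idem)
  moreover have "wf_com R S (f x)" using Case.prems(1) x by auto
  ultimately show ?case
    using Case.IH[OF rangeI _ 1(2,3)] reaches_trans[OF 1(1)] by metis
next
  case (Loop r f)
  from Loop.prems(2,3) show ?case
  proof (induction "\<sigma> r" arbitrary: \<sigma> ts)
    case Nil
    have r: "r < R" "length ts = R" using Loop.prems(1) Nil by (auto simp: tapes_hold_def)
    have *: "tape_read (ts ! r) = b"
      using tapes_hold_read(2)[OF Nil(3) r(1) b] Nil(1) by simp
    have "reaches M (e (Run (Loop r f # K)), ts) (e (Run K), ts)"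
      by (rule reaches_1)
        (use tm_step_ctl[OF Loop.prems(2)] * r in \<open>simp add: map2_tape_act_stay\<close>)
    moreover have "Run K \<in> Q"
      using closed_tapes[OF Nil(2,3)] * r by simp
    moreover have "\<sigma>(r := []) = \<sigma>" using Nil(1) by (simp add: fun_eq_iff)
    ultimately show ?case using Nil by auto
  next
    case (Cons s xs)
    have r: "r < R" "length ts = R" "s \<in> S"
      using Loop.prems(1) Cons(2)[symmetric] Cons(4) by (auto simp: tapes_hold_def)
    have *: "tape_read (ts ! r) = s" "s \<noteq> b"
      using tapes_hold_read[OF Cons(4) r(1) b] Cons(2)[symmetric] by auto
    have wf: "wf_com R S (f s)" "untouched r (f s)" using Loop.prems(1) r by auto
    let ?ts = "ts[r := tape_act (tape_read (ts ! r), Move_Right) (ts ! r)]"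
    have 1: "reaches M (e (Run (Loop r f # K)), ts) (e (Run (f s # Loop r f # K)), ?ts)"
      by (rule reaches_1)
        (use tm_step_ctl[OF Loop.prems(2)] * r in \<open>simp add: map2_tape_act_update\<close>)
    have Q: "Run (f s # Loop r f # K) \<in> Q"
      using closed_tapes[OF Cons(3,4)] * r by simp
    obtain ts' where 2: "reaches M (e (Run (f s # Loop r f # K)), ?ts) (e (Run (Loop r f # K)), ts')"
      and ts': "Run (Loop r f # K) \<in> Q" "tapes_hold b S R ts' (exec (f s) (\<sigma>(r := xs)))"
      using Loop.IH[OF rangeI wf(1) Q tapes_hold_pop[OF Cons(4) r(1) Cons(2)[symmetric]]] by blast
    have "xs = exec (f s) (\<sigma>(r := xs)) r"
      using exec_untouched[OF wf(2), of \<sigma> xs] by simp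
    from Cons(1)[OF this ts'] obtain ts'' where
      "reaches M (e (Run (Loop r f # K)), ts') (e (Run K), ts'')" "Run K \<in> Q"
      "tapes_hold b S R ts'' (exec (Loop r f) \<sigma>)"
      using exec_Loop_Cons[of r f s \<sigma> xs] wf(2) Cons(2) by auto
    then show ?case using reaches_trans[OF 1 reaches_trans[OF 2]] by blast
  qed
qed

end

theorem decidable_by_com:
  fixes \<Sigma> :: "'a set" and S :: "('a + nat) set"
  assumes "L \<subseteq> lists \<Sigma>" "finite S" "Inl ` \<Sigma> \<subseteq> S" "b \<notin> S"
    and wf: "wf_com R S c" and "0 < R" "out < R"
    and correct: "\<And>w. w \<in> lists \<Sigma> \<Longrightarrow> exec c ((\<lambda>r. [])(0 := map Inl w)) out \<noteq> [] \<longleftrightarrow> w \<in> L"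
  shows "decidable_language \<Sigma> L"
proof -
  define C where "C = insert [] (conts S c [])"
  define Q where "Q = Run ` C \<union> Write ` C \<union> range Halt"
  have "finite C" using finite_conts[OF \<open>finite S\<close>] by (simp add: C_def)
  moreover have "range Halt = {Halt True, Halt False}" by (simp add: UNIV_bool insert_commute)
  ultimately have "finite Q" by (simp add: Q_def)
  then obtain e :: "('a + nat) ctl \<Rightarrow> nat" where e: "inj_on e Q"
    using finite_imp_inj_to_nat_seg by blast
  have closed: "fst (ctl_step b out q ss) \<in> Q \<and> length (snd (ctl_step b out q ss)) = R \<and>
      fst ` set (snd (ctl_step b out q ss)) \<subseteq> insert b S"
    if q: "q \<in> Q" and ss: "length ss = R" "set ss \<subseteq> insert b S" for q ss
  proof -
    have stay: "fst ` set (stay ss) \<subseteq> insert b S" "length (stay ss) = R"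
      using ss by (auto simp: stay_def)
    consider h where "q = Halt h" | L where "q \<in> {Run L, Write L}" "L \<in> C"
      using q by (auto simp: Q_def)
    then show ?thesis
    proof cases
      case 1
      then show ?thesis using stay q by simp
    next
      case 2
      have "list_all (wf_com R S) L"
        using 2(2) wf_conts[OF _ wf] by (auto simp: C_def)
      moreover have "fst (ctl_step b out q ss) \<in> Q"
      proof (cases "L = []")
        case True
        then show ?thesis using 2 by (auto simp: Q_def)
      next
        case False
        then have "L \<in> conts S c []" using 2(2) by (simp add: C_def)
        then show ?thesis
          using conts_step[OF _ wf ss(2,1) 2(1), of "[]" out] by (auto simp: Q_def C_def)
      qed
      ultimately show ?thesis
        using ctl_step_actions[OF 2(1) _ ss(2,1) refl, of out] by blast
    qed
  qed
  define M where "M = \<lparr>tm_tapes = R, tm_states = e ` Q, tm_symbols = insert b S, tm_blank = b,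
    tm_start = e (Run [c]), tm_accept = e (Halt True), tm_reject = e (Halt False),
    tm_delta = \<lambda>q ss. map_prod e id (ctl_step b out (inv_into Q e q) ss)\<rparr>"
  have start: "Run [c] \<in> Q" using Cons_in_conts[of c "[]" S] by (simp add: Q_def C_def)
  have halts: "Halt h \<in> Q" for h by (simp add: Q_def)
  have ne: "e (Halt True) \<noteq> e (Halt False)" using inj_onD[OF e] halts by blast
  have tm: "turing_machine \<Sigma> M"
    unfolding turing_machine_def
  proof (intro conjI ballI allI impI)
    fix q ss assume "q \<in> tm_states M" and ss: "length ss = tm_tapes M \<and> set ss \<subseteq> tm_symbols M"
    then obtain q0 where "q0 \<in> Q" "q = e q0" by (auto simp: M_def)
    then show "case tm_delta M q ss of (q', as) \<Rightarrow>
        q' \<in> tm_states M \<and> length as = tm_tapes M \<and> fst ` set as \<subseteq> tm_symbols M"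
      using closed[of q0 ss] ss by (simp add: M_def inv_into_f_f[OF e] case_prod_beta)
  qed (use assms \<open>finite Q\<close> start halts ne in \<open>auto simp: M_def\<close>)
  interpret ctl_tm M e Q b S R out
    by unfold_locales (use e halts closed assms(4) in \<open>auto simp: M_def inv_into_f_f[OF e]\<close>)
  have "tm_halts_in M w (e (Halt (w \<in> L)))" if w: "w \<in> lists \<Sigma>" for w
  proof -
    let ?\<sigma> = "(\<lambda>r. [])(0 := map Inl w)"
    let ?ts = "input_tape b (map Inl w) # replicate (R - 1) (input_tape b [])"
    have "tapes_hold b S R ?ts ?\<sigma>"
      unfolding tapes_hold_def
    proof (intro conjI allI impI)
      fix r assume "r < R"
      then show "on_tape b (fst (?ts ! r)) (snd (?ts ! r)) (?\<sigma> r)"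
        using on_tape_input[of b "map Inl w"] on_tape_input[of b "[]"] by (cases r) auto
      show "set (?\<sigma> r) \<subseteq> S" using w assms(3) by (auto simp: in_lists_conv_set)
    qed (use \<open>0 < R\<close> in simp)
    then obtain ts where reach: "reaches M (e (Run [c]), ?ts) (e (Run []), ts)"
      and Q: "Run [] \<in> Q" and ts: "tapes_hold b S R ts (exec c ?\<sigma>)"
      using run_com[OF wf start] by blast
    have "length ts = R" using ts by (simp add: tapes_hold_def)
    then have "map tape_read ts ! out \<noteq> b \<longleftrightarrow> w \<in> L"
      using tapes_hold_read(2)[OF ts \<open>out < R\<close> assms(4)] correct[OF w] \<open>out < R\<close> by simp
    then have "tm_step M (e (Run []), ts) = (e (Halt (w \<in> L)), ts)"
      using tm_step_ctl[OF Q] by (simp add: map2_tape_act_stay)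
    with reach have "reaches M (tm_init M w) (e (Halt (w \<in> L)), ts)"
      by (metis (no_types, lifting) M_def reaches_1 reaches_trans tm_init_def tm.simps(1,4,5))
    then show ?thesis by (metis fst_conv reaches_def tm_halts_in_def)
  qed
  then have "\<forall>w\<in>lists \<Sigma>. (w \<in> L \<longrightarrow> tm_accepts M w) \<and> (w \<notin> L \<longrightarrow> tm_rejects M w)"
    unfolding tm_accepts_def tm_rejects_def accept reject by metis
  then show ?thesis using assms(1) tm unfolding decidable_language_def by blast
qed

section \<open>Magnus coefficients\<close>

definition letter_sign :: "'a letter \<Rightarrow> int" where
  "letter_sign l = (if snd l then 1 else -1)"

text \<open>
  Send the two generators \<open>0\<close> and \<open>1\<close> to \<open>1 + X\<^sub>0\<close> and \<open>1 + X\<^sub>1\<close> in the ring of noncommutative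
  polynomials over the integers modulo \<open>X\<^sub>0\<^sup>2 = X\<^sub>1\<^sup>2 = 0\<close>. Its monomials are alternating, and
  \<open>magnus w s n\<close> is the coefficient of the one that has degree \<open>n\<close> and begins with \<open>X\<^sub>s\<close>.
\<close>

fun magnus :: "nat letter list \<Rightarrow> nat \<Rightarrow> nat \<Rightarrow> int" where
  "magnus w s 0 = 1"
| "magnus [] s (Suc n) = 0"
| "magnus (l # w) s (Suc n) =
     magnus w s (Suc n) + (if fst l = s then letter_sign l * magnus w (1 - s) n else 0)"

lemma magnus_Nil: "magnus [] s n = (if n = 0 then 1 else 0)"
  by (cases n) auto

lemma magnus_append:
  "magnus (u @ v) s n = (\<Sum>i\<le>n. magnus u s i * magnus v (((-) 1 ^^ i) s) (n - i))"
proof (induction u arbitrary: s n)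
  case Nil
  have "(\<Sum>i\<le>n. magnus [] s i * magnus v (((-) 1 ^^ i) s) (n - i)) =
      (\<Sum>i\<le>n. if i = 0 then magnus v (((-) 1 ^^ i) s) (n - i) else 0)"
    by (rule sum.cong) (auto simp: magnus_Nil)
  then show ?case by simp
next
  case (Cons l u)
  show ?case
  proof (cases n)
    case (Suc m)
    let ?e = "if fst l = s then letter_sign l else 0"
    let ?v = "\<lambda>i. magnus v (((-) 1 ^^ Suc i) s) (m - i)"
    have "magnus ((l # u) @ v) s n = magnus (u @ v) s (Suc m) + ?e * magnus (u @ v) (1 - s) m"
      by (simp add: Suc)
    also have "magnus (u @ v) s (Suc m) = magnus v s (Suc m) + (\<Sum>i\<le>m. magnus u s (Suc i) * ?v i)"
      unfolding Cons.IH sum.atMost_Suc_shift by simp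
    also have "magnus (u @ v) (1 - s) m = (\<Sum>i\<le>m. magnus u (1 - s) i * ?v i)"
      unfolding Cons.IH by (simp only: funpow_Suc_right o_apply)
    also have "magnus v s (Suc m) + (\<Sum>i\<le>m. magnus u s (Suc i) * ?v i) +
        ?e * (\<Sum>i\<le>m. magnus u (1 - s) i * ?v i) =
        magnus v s (Suc m) + (\<Sum>i\<le>m. magnus (l # u) s (Suc i) * ?v i)"
      by (simp add: sum_distrib_left sum.distrib[symmetric] algebra_simps)
    also have "\<dots> = (\<Sum>i\<le>n. magnus (l # u) s i * magnus v (((-) 1 ^^ i) s) (n - i))"
      unfolding Suc sum.atMost_Suc_shift by simp
    finally show ?thesis .
  qed simp
qed

lemma one_minus_neq: "(x :: nat) \<noteq> Suc 0 - x"
  by arith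

lemma magnus_cons_reduce: "magnus (cons_reduce l w) s n = magnus (l # w) s n"
proof (cases "w \<noteq> [] \<and> hd w = inv_letter l")
  case True
  then obtain v where w: "w = inv_letter l # v" by (cases w) auto
  have "magnus (l # inv_letter l # v) s n = magnus v s n" for n
    using one_minus_neq[of "fst l"] by (cases n; cases "n - 1") (auto simp: inv_letter_def letter_sign_def)
  then show ?thesis by (simp add: w)
next
  case False
  then show ?thesis by (cases w) auto
qed

lemma magnus_Cons_cong:
  assumes "\<And>s n. magnus u s n = magnus v s n"
  shows "magnus (l # u) s n = magnus (l # v) s n"
  using assms by (cases n) auto

lemma magnus_reduce: "magnus (reduce w) s n = magnus w s n"
proof (induction w arbitrary: s n)
  case (Cons l w)
  have "reduce (l # w) = cons_reduce l (reduce w)" by (simp add: reduce_def)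
  then show ?case by (simp only: magnus_cons_reduce magnus_Cons_cong[OF Cons.IH])
qed (simp add: reduce_def)

lemma abs_magnus_le: "\<bar>magnus w s n\<bar> \<le> 2 ^ length w"
proof (induction w arbitrary: s n)
  case (Cons l w)
  show ?case
  proof (cases n)
    case (Suc m)
    show ?thesis
      using Cons.IH[of s n] Cons.IH[of "1 - s" m] by (auto simp: Suc letter_sign_def)
  qed (use one_le_power[of "2 :: int" "length (l # w)"] in simp)
qed (simp add: magnus_Nil)

lemma magnus_outside: "w \<in> words X \<Longrightarrow> s \<notin> X \<Longrightarrow> magnus w s (Suc n) = 0"
  by (induction w arbitrary: n) (auto simp: words_def)

text \<open>
  The inequality on the two leading coefficients is an invariant that excludes cancellation when a
  further letter is prepended.
\<close>

lemma magnus_leading: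
  assumes "reduced (l # w)" "l # w \<in> words {0, 1}"
  shows "\<exists>m. magnus (l # w) (fst l) (Suc m) * magnus (l # w) (1 - fst l) m * letter_sign l > 0 \<and>
    (\<forall>i>Suc m. magnus (l # w) (fst l) i = 0) \<and> (\<forall>i>m. magnus (l # w) (1 - fst l) i = 0)"
  using assms
proof (induction w arbitrary: l)
  case Nil
  have "magnus [l] (fst l) i = 0" if "i > Suc 0" for i
    using that by (cases i) (auto simp: magnus_Nil)
  moreover have "magnus [l] (1 - fst l) i = 0" if "i > 0" for i
    using that one_minus_neq[of "fst l"] by (cases i) (auto simp: magnus_Nil)
  ultimately show ?case by (intro exI[of _ 0]) (auto simp: letter_sign_def)
next
  case (Cons k w)
  let ?s = "fst l" and ?v = "k # w"
  have s: "?s \<in> {0, 1}" "fst k \<in> {0, 1}" using Cons.prems(2) by (auto simp: words_def)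
  have sq: "letter_sign l * letter_sign l = 1" by (simp add: letter_sign_def)
  obtain m where m: "magnus ?v (fst k) (Suc m) * magnus ?v (1 - fst k) m * letter_sign k > 0"
    "\<And>i. i > Suc m \<Longrightarrow> magnus ?v (fst k) i = 0" "\<And>i. i > m \<Longrightarrow> magnus ?v (1 - fst k) i = 0"
    using Cons.IH[of k] Cons.prems by (auto simp: reduced_Cons words_def)
  have step: "magnus (l # ?v) ?s (Suc i) = magnus ?v ?s (Suc i) + letter_sign l * magnus ?v (1 - ?s) i"
    "magnus (l # ?v) (1 - ?s) i = magnus ?v (1 - ?s) i" for i
    by simp (use s in \<open>cases i; auto\<close>)
  show ?case
  proof (cases "fst k = ?s")
    case True
    then have "k = l"
      using Cons.prems(1) by (auto simp: reduced_Cons inv_letter_def prod_eq_iff)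
    then have k: "fst k = ?s" "letter_sign k = letter_sign l" by simp_all
    let ?A = "magnus ?v ?s (Suc m)" and ?B = "magnus ?v (1 - ?s) m" and ?e = "letter_sign l"
    have "(?A + ?e * ?B) * ?B * ?e = ?A * ?B * ?e + (?e * ?e) * ?B\<^sup>2"
      by (simp add: algebra_simps power2_eq_square)
    then have "(?A + ?e * ?B) * ?B * ?e > 0"
      using m(1) sq by (simp del: magnus.simps add: k add_pos_nonneg)
    moreover have "magnus (l # ?v) ?s i = 0" if "i > Suc m" for i
      using that m(2,3) step(1)[of "i - 1"] by (simp del: magnus.simps add: k)
    ultimately show ?thesis
      using m(3) by (intro exI[of _ m]) (simp del: magnus.simps add: step[unfolded One_nat_def] k)
  next
    case False
    then have k: "fst k = 1 - ?s" "1 - fst k = ?s" using s by auto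
    let ?A = "magnus ?v (1 - ?s) (Suc m)"
    have "?A \<noteq> 0" using m(1) k by auto
    moreover have "(0 + letter_sign l * ?A) * ?A * letter_sign l = (letter_sign l * letter_sign l) * ?A\<^sup>2"
      by (simp add: algebra_simps power2_eq_square)
    ultimately have "(0 + letter_sign l * ?A) * ?A * letter_sign l > 0"
      using sq by simp
    moreover have "magnus ?v ?s (Suc (Suc m)) = 0" using m(3) k by (simp del: magnus.simps)
    moreover have "magnus (l # ?v) ?s i = 0" if "i > Suc (Suc m)" for i
      using that m(2)[of "i - 1"] m(3)[of i] step(1)[of "i - 1"] k by (simp del: magnus.simps)
    moreover have "magnus ?v (1 - ?s) i = 0" if "i > Suc m" for i
      using that m(2)[of i] k by (simp del: magnus.simps)
    ultimately show ?thesis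
      by (intro exI[of _ "Suc m"]) (simp del: magnus.simps add: step[unfolded One_nat_def] k)
  qed
qed

lemma magnus_inject:
  assumes "u \<in> carrier F2" "v \<in> carrier F2" and eq: "\<And>s n. magnus u s n = magnus v s n"
  shows "u = v"
proof -
  interpret F: group F2 by (rule group_free_group)
  let ?i = "rev (map inv_letter u)"
  have "magnus (reduce (?i @ v)) s n = magnus (reduce (?i @ u)) s n" for s n
    by (simp only: magnus_reduce magnus_append eq)
  then have triv: "magnus (reduce (?i @ v)) s n = magnus [] s n" for s n
    by (simp add: reduce_inverse)
  have i: "?i \<in> words {0, 1}"
    using assms(1) by (auto simp: free_group_def words_def inv_letter_def lists_eq_set)
  have "reduce (?i @ v) = []"
  proof (rule ccontr)
    assume "reduce (?i @ v) \<noteq> []"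
    then obtain l w where lw: "reduce (?i @ v) = l # w" by (cases "reduce (?i @ v)") auto
    moreover have "reduce (?i @ v) \<in> words {0, 1}"
      using assms(2) i by (intro words_reduce) (auto simp: free_group_def words_def)
    ultimately obtain m where "magnus (l # w) (fst l) (Suc m) \<noteq> 0"
      using magnus_leading[of l w] reduced_reduce[of "?i @ v"] by fastforce
    with triv[of "fst l" "Suc m"] show False by (simp add: lw)
  qed
  then have "reduce ?i \<otimes>\<^bsub>F2\<^esub> v = \<one>\<^bsub>F2\<^esub>" "reduce ?i \<otimes>\<^bsub>F2\<^esub> u = \<one>\<^bsub>F2\<^esub>"
    by (simp_all add: free_group_def reduce_append_left reduce_inverse)
  moreover have "reduce ?i \<in> carrier F2"
    using i by (simp add: free_group_def words_reduce reduced_reduce)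
  ultimately show ?thesis
    using assms F.inv_equality F.inv_inv by metis
qed

lemma magnus_subst:
  assumes low: "\<And>l s m. l \<in> X \<times> UNIV \<Longrightarrow> m < n \<Longrightarrow> magnus (f l) s m = magnus [l] s m"
    and "0 < n" "w \<in> words X"
  shows "m < n \<Longrightarrow> magnus (concat (map f w)) s m = magnus w s m"
    and "magnus (concat (map f w)) s n =
      magnus w s n + (\<Sum>l\<leftarrow>w. magnus (f l) s n - magnus [l] s n)"
  using assms(3)
proof (induction w arbitrary: s m)
  case Nil
  {
    case 1
    then show ?case by simp
  next
    case 2
    then show ?case by simp
  }
next
  case (Cons l w)
  let ?W = "concat (map f w)"
  {
    case 1
    then have l: "l \<in> X \<times> UNIV" "w \<in> words X" by (auto simp: words_def)
    have "magnus (f l @ ?W) s m = magnus ([l] @ w) s m"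
      unfolding magnus_append
      by (rule sum.cong) (use 1 l low Cons.IH(1) in auto)
    then show ?case by simp
  next
    case 2
    let ?s = "\<lambda>i. ((-) 1 ^^ i) s"
    from 2 have l: "l \<in> X \<times> UNIV" "w \<in> words X" by (auto simp: words_def)
    obtain n' where n': "n = Suc n'" using \<open>0 < n\<close> by (cases n) auto
    have split: "magnus (u @ v) s n = magnus v s n + magnus u s n +
        (\<Sum>i<n'. magnus u s (Suc i) * magnus v (?s (Suc i)) (n' - i))" for u v
    proof -
      let ?g = "\<lambda>i. magnus u s i * magnus v (?s i) (n - i)"
      have "(\<Sum>i\<le>n. ?g i) = ?g 0 + (\<Sum>i\<le>n'. ?g (Suc i))"
        unfolding n' sum.atMost_Suc_shift ..
      also have "\<dots> = ?g 0 + ((\<Sum>i<n'. ?g (Suc i)) + ?g (Suc n'))"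
        by (simp only: lessThan_Suc_atMost[symmetric] sum.lessThan_Suc)
      finally have "(\<Sum>i\<le>n. ?g i) = ?g 0 + ((\<Sum>i<n'. ?g (Suc i)) + ?g (Suc n'))" .
      moreover have "?g 0 = magnus v s n" by simp
      moreover have "?g (Suc n') = magnus u s n" by (simp add: n')
      moreover have "?g (Suc i) = magnus u s (Suc i) * magnus v (?s (Suc i)) (n' - i)" for i
        by (simp add: n')
      ultimately show ?thesis unfolding magnus_append by (simp only: ac_simps)
    qed
    have "(\<Sum>i<n'. magnus (f l) s (Suc i) * magnus ?W (?s (Suc i)) (n' - i)) =
        (\<Sum>i<n'. magnus [l] s (Suc i) * magnus w (?s (Suc i)) (n' - i))"
      by (rule sum.cong) (use l low[of l] Cons.IH(1) n' in auto)
    then have "magnus (f l @ ?W) s n - magnus ([l] @ w) s n =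
        magnus ?W s n - magnus w s n + (magnus (f l) s n - magnus [l] s n)"
      unfolding split by simp
    then show ?case using Cons.IH(2)[OF l(2)] by simp
  }
qed


definition expsum :: "'a letter list \<Rightarrow> 'a \<Rightarrow> int" where
  "expsum w x = (\<Sum>l\<leftarrow>w. if fst l = x then letter_sign l else 0)"

lemma magnus_1: "magnus w s (Suc 0) = expsum w s"
  by (induction w) (auto simp: expsum_def)

lemma abs_expsum_le: "\<bar>expsum w x\<bar> \<le> int (length w)"
  by (induction w) (auto simp: expsum_def letter_sign_def)

lemma sum_list_letters:
  assumes "w \<in> words X" "finite X" and inv: "\<And>x. x \<in> X \<Longrightarrow> c (x, False) = - c (x, True)"
  shows "(\<Sum>l\<leftarrow>w. c l) = (\<Sum>x\<in>X. expsum w x * c (x, True))"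
  using assms(1)
proof (induction w)
  case (Cons l w)
  then have l: "fst l \<in> X" "w \<in> words X" by (auto simp: words_def)
  have "(\<Sum>x\<in>X. (if fst l = x then letter_sign l else 0) * c (x, True)) =
      (\<Sum>x\<in>X. if x = fst l then letter_sign l * c (x, True) else 0)"
    by (rule sum.cong) auto
  also have "\<dots> = c l"
    using l(1) \<open>finite X\<close> inv[OF l(1)] by (cases l) (auto simp: letter_sign_def)
  finally show ?case
    using Cons.IH[OF l(2)] by (simp add: expsum_def distrib_right sum.distrib)
qed (simp add: expsum_def)

lemma hom_free_group_reduce:
  assumes "\<phi> \<in> hom (free_group X) (free_group X)" "w \<in> carrier (free_group X)"
  shows "\<phi> w = reduce (concat (map (\<lambda>l. \<phi> [l]) w))"
  using assms(2)
proof (induction w)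
  case Nil
  have "\<phi> \<one>\<^bsub>free_group X\<^esub> = \<one>\<^bsub>free_group X\<^esub>"
    by (rule hom_one[OF assms(1) group_free_group group_free_group])
  then show ?case by (simp add: free_group_def reduce_def)
next
  case (Cons l w)
  then have lw: "[l] \<in> carrier (free_group X)" "w \<in> carrier (free_group X)"
    by (auto simp: free_group_def words_def reduced_Cons)
  have "l # w = [l] \<otimes>\<^bsub>free_group X\<^esub> w"
    using Cons.prems by (simp add: free_group_def reduce_reduced)
  then have "\<phi> (l # w) = reduce (\<phi> [l] @ \<phi> w)"
    using hom_mult[OF assms(1) lw] by (simp add: free_group_def)
  with Cons.IH[OF lw(2)] show ?case by (simp add: reduce_append_right)
qed

lemma magnus_hom:
  assumes \<phi>: "\<phi> \<in> hom (free_group X) (free_group X)" and "finite X"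
    and low: "\<And>l s m. l \<in> X \<times> UNIV \<Longrightarrow> m < n \<Longrightarrow> magnus (\<phi> [l]) s m = magnus [l] s m"
    and "0 < n" "w \<in> carrier (free_group X)"
  shows "magnus (\<phi> w) s n = magnus w s n +
    (\<Sum>x\<in>X. expsum w x * (magnus (\<phi> [(x, True)]) s n - magnus [(x, True)] s n))"
proof -
  let ?c = "\<lambda>l. magnus (\<phi> [l]) s n - magnus [l] s n"
  have subst: "magnus (concat (map (\<lambda>l. \<phi> [l]) v)) s n = magnus v s n + (\<Sum>l\<leftarrow>v. ?c l)"
    if "v \<in> words X" for v
    by (rule magnus_subst(2)[OF low \<open>0 < n\<close> that])
  have "?c (x, False) = - ?c (x, True)" if "x \<in> X" for x
  proof -
    let ?v = "[(x, True), (x, False)]"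
    have F: "[(x, b)] \<in> carrier (free_group X)" for b
      using that by (simp add: free_group_def words_def reduced_Cons)
    have "[(x, True)] \<otimes>\<^bsub>free_group X\<^esub> [(x, False)] = \<one>\<^bsub>free_group X\<^esub>"
      by (simp add: free_group_def reduce_def inv_letter_def)
    then have "\<phi> [(x, True)] \<otimes>\<^bsub>free_group X\<^esub> \<phi> [(x, False)] = \<one>\<^bsub>free_group X\<^esub>"
      using hom_mult[OF \<phi> F F] hom_one[OF \<phi> group_free_group group_free_group] by metis
    then have "magnus (concat (map (\<lambda>l. \<phi> [l]) ?v)) s n = magnus [] s n"
      using magnus_reduce[of "\<phi> [(x, True)] @ \<phi> [(x, False)]" s n] by (simp add: free_group_def)
    moreover have "magnus ?v s n = magnus [] s n"
      using magnus_reduce[of ?v s n] by (simp add: reduce_def inv_letter_def)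
    ultimately show ?thesis
      using subst[of ?v] that by (simp add: words_def)
  qed
  then have "(\<Sum>l\<leftarrow>w. ?c l) = (\<Sum>x\<in>X. expsum w x * ?c (x, True))"
    using assms(5) \<open>finite X\<close> by (intro sum_list_letters) (auto simp: free_group_def)
  moreover have "magnus (\<phi> w) s n = magnus (concat (map (\<lambda>l. \<phi> [l]) w)) s n"
    using hom_free_group_reduce[OF \<phi> assms(5)] magnus_reduce by metis
  ultimately show ?thesis
    using subst[of w] assms(5) by (simp add: free_group_def)
qed

lemma expsum_hom:
  assumes \<phi>: "\<phi> \<in> hom F2 F2" and "w \<in> carrier F2"
  shows "expsum (\<phi> w) s = (\<Sum>x\<in>{0, 1}. expsum w x * expsum (\<phi> [(x, True)]) s)"
proof -
  have "expsum (\<phi> w) s = expsum w s +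
      (\<Sum>x\<in>{0, 1}. expsum w x * (expsum (\<phi> [(x, True)]) s - expsum [(x, True)] s))"
    using magnus_hom[OF \<phi> _ _ _ assms(2), of "Suc 0" s] by (simp add: magnus_1)
  moreover have "expsum w s = (\<Sum>x\<in>{0, 1}. expsum w x * expsum [(x, True)] s)"
  proof (cases "s \<in> {0, 1}")
    case False
    then have "expsum w s = 0"
      using magnus_outside[of w "{0, 1}" s 0] assms(2) by (simp add: magnus_1 free_group_def)
    with False show ?thesis by (auto simp: expsum_def)
  qed (auto simp: expsum_def letter_sign_def)
  ultimately show ?thesis by (simp add: algebra_simps)
qed

text \<open>
  By Cayley-Hamilton, every entry of the powers of a \<open>2 \<times> 2\<close> matrix with trace \<open>t\<close> and determinant
  \<open>\<plusminus>1\<close> satisfies one of the recurrences in the next two lemmas.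
\<close>

lemma recurrence_growth_pos:
  fixes Z :: "nat \<Rightarrow> int"
  assumes rec: "\<And>k. Z (Suc (Suc k)) = t * Z (Suc k) - Z k" and "\<bar>t\<bar> \<ge> 2" "Z 0 = 0" "Z 1 \<noteq> 0"
  shows "\<bar>Z k\<bar> \<ge> int k"
proof -
  have step: "\<bar>Z (Suc k)\<bar> \<ge> \<bar>Z k\<bar> + 1" for k
  proof (induction k)
    case (Suc k)
    have "\<bar>t * Z (Suc k)\<bar> \<ge> 2 * \<bar>Z (Suc k)\<bar>"
      unfolding abs_mult using assms(2) by (intro mult_right_mono) auto
    then show ?case using Suc rec[of k] by linarith
  qed (use assms in simp)
  show ?thesis
  proof (induction k)
    case (Suc k)
    then show ?case using step[of k] unfolding of_nat_Suc by linarith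
  qed simp
qed

lemma recurrence_growth_neg:
  fixes Z :: "nat \<Rightarrow> int"
  assumes rec: "\<And>k. Z (Suc (Suc k)) = t * Z (Suc k) + Z k" and "t \<noteq> 0" "Z 0 = 0" "Z 1 \<noteq> 0"
  shows "\<bar>Z k\<bar> \<ge> int k - 1"
proof -
  have sum: "\<bar>Z (Suc (Suc k))\<bar> \<ge> \<bar>Z (Suc k)\<bar> + \<bar>Z k\<bar>" if "t * Z (Suc k) * Z k \<ge> 0" for k
  proof -
    have "\<bar>t * Z (Suc k)\<bar> \<ge> 1 * \<bar>Z (Suc k)\<bar>"
      unfolding abs_mult using assms(2) by (intro mult_right_mono) auto
    moreover have "\<bar>t * Z (Suc k) + Z k\<bar> = \<bar>t * Z (Suc k)\<bar> + \<bar>Z k\<bar>"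
      using that by (auto simp: zero_le_mult_iff)
    ultimately show ?thesis using rec[of k] by linarith
  qed
  have "t * Z (Suc k) * Z k \<ge> 0 \<and> \<bar>Z (Suc k)\<bar> \<ge> 1 \<and> (k = 0 \<or> \<bar>Z k\<bar> \<ge> 1) \<and> \<bar>Z (Suc k)\<bar> \<ge> int k" for k
  proof (induction k)
    case 0
    then show ?case using assms by auto
  next
    case (Suc k)
    have "t * Z (Suc (Suc k)) * Z (Suc k) = (t * Z (Suc k))\<^sup>2 + t * Z (Suc k) * Z k"
      by (simp add: rec power2_eq_square algebra_simps)
    then have "t * Z (Suc (Suc k)) * Z (Suc k) \<ge> 0" using Suc by simp
    then show ?case using Suc sum[of k] by (cases "k = 0") auto
  qed
  then show ?thesis by (cases k) (auto simp: algebra_simps)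
qed

lemma matrix_powers:
  fixes a b c d :: int
  assumes det: "\<bar>a * d - b * c\<bar> = 1"
  defines "rec \<equiv> \<lambda>X Y :: nat \<Rightarrow> int. \<forall>k. X (Suc k) = a * X k + b * Y k \<and> Y (Suc k) = c * X k + d * Y k"
  obtains "\<And>X Y. rec X Y \<Longrightarrow> X 12 = X 0 \<and> Y 12 = Y 0"
  | "\<And>X Y k. rec X Y \<Longrightarrow> X 0 = 0 \<Longrightarrow> Y 0 = 1 \<Longrightarrow> \<bar>X k\<bar> \<ge> int k - 1"
  | "\<And>X Y k. rec X Y \<Longrightarrow> X 0 = 1 \<Longrightarrow> Y 0 = 0 \<Longrightarrow> \<bar>Y k\<bar> \<ge> int k - 1"
proof -
  define t D where "t = a + d" and "D = a * d - b * c"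
  have D: "D = 1 \<or> D = -1" using det by (auto simp: D_def)
  have cayley: "X (Suc (Suc k)) = t * X (Suc k) - D * X k" "Y (Suc (Suc k)) = t * Y (Suc k) - D * Y k"
    if "rec X Y" for X Y k
    using that by (simp_all add: rec_def t_def D_def algebra_simps)
  have growth: "\<bar>Z k\<bar> \<ge> int k - 1"
    if "\<And>k. Z (Suc (Suc k)) = t * Z (Suc k) - D * Z k" "Z 0 = 0" "Z 1 \<noteq> 0"
      "D = 1 \<and> \<bar>t\<bar> \<ge> 2 \<or> D = -1 \<and> t \<noteq> 0" for Z k
    using that recurrence_growth_pos[of Z t k] recurrence_growth_neg[of Z t k] by auto
  have period: "Z 12 = Z 0"
    if "\<And>k. Z (Suc (Suc k)) = t * Z (Suc k) - D * Z k"
      "D = 1 \<and> t \<in> {-1, 0, 1} \<or> D = -1 \<and> t = 0" for Z :: "nat \<Rightarrow> int"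
    using that(2) by (auto simp: numeral_eq_Suc that(1))
  consider (small) "D = 1 \<and> t \<in> {-1, 0, 1} \<or> D = -1 \<and> t = 0"
    | (large) "D = 1 \<and> \<bar>t\<bar> \<ge> 2 \<or> D = -1 \<and> t \<noteq> 0"
    using D by fastforce
  then show ?thesis
  proof cases
    case small
    then show ?thesis using that(1) period cayley by blast
  next
    case large
    consider "b \<noteq> 0" | "c \<noteq> 0" | "b = 0" "c = 0" by blast
    then show ?thesis
    proof cases
      case 1
      show ?thesis
        by (rule that(2), rule growth) (use 1 large cayley in \<open>auto simp: rec_def\<close>)
    next
      case 2
      show ?thesis
        by (rule that(3), rule growth) (use 2 large cayley in \<open>auto simp: rec_def\<close>)
    next
      case 3
      then have "a = 1 \<or> a = -1" "d = 1 \<or> d = -1"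
        using det abs_zmult_eq_1[of a d] abs_zmult_eq_1[of d a] by (auto simp: mult.commute)
      then show ?thesis
        using 3 by (intro that(1)) (auto simp: rec_def numeral_eq_Suc)
    qed
  qed
qed

section \<open>A bound on the exponent\<close>

lemma funpow_hom: "\<phi> \<in> hom G G \<Longrightarrow> (\<phi> ^^ k) \<in> hom G G"
  by (induction k) (auto simp: hom_def Pi_iff)

lemma funpow_image: "\<phi> ` A = A \<Longrightarrow> (\<phi> ^^ k) ` A = A"
proof (induction k)
  case (Suc k)
  have "(\<phi> ^^ Suc k) ` A = \<phi> ` ((\<phi> ^^ k) ` A)" by (simp add: image_image)
  with Suc show ?case by simp
qed simp

lemma letter_in_F2: "l \<in> {0, 1} \<times> UNIV \<Longrightarrow> [l] \<in> carrier F2"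
  by (auto simp: free_group_def words_def reduced_Cons)

text \<open>
  In the lowest degree \<open>n\<close> where \<open>\<psi>\<close> changes a coefficient, the change is additive, hence linear in
  the number of applications of \<open>\<psi>\<close>.
\<close>

lemma magnus_funpow:
  assumes \<psi>: "\<psi> \<in> hom F2 F2"
    and expsum: "\<And>w s. w \<in> carrier F2 \<Longrightarrow> expsum (\<psi> w) s = expsum w s"
    and l: "l \<in> {0, 1} \<times> UNIV" "\<psi> [l] \<noteq> [l]"
  shows "\<exists>n s C.
    (\<forall>w\<in>carrier F2. \<forall>j. magnus ((\<psi> ^^ j) w) s n =
       magnus w s n + int j * (\<Sum>x\<in>{0, 1}. expsum w x * C x)) \<and>
    (\<exists>w\<in>carrier F2. (\<Sum>x\<in>{0, 1}. expsum w x * C x) \<noteq> 0)"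
proof -
  have \<psi>_in: "\<psi> w \<in> carrier F2" if "w \<in> carrier F2" for w
    using \<psi> that by (auto simp: hom_def)
  define P where "P n \<longleftrightarrow> (\<exists>l\<in>{0, 1} \<times> UNIV. \<exists>s. magnus (\<psi> [l]) s n \<noteq> magnus [l] s n)" for n
  have "\<exists>n. P n"
    using magnus_inject[OF \<psi>_in letter_in_F2] letter_in_F2 l unfolding P_def by metis
  then obtain n where n: "P n" "\<And>m. m < n \<Longrightarrow> \<not> P m"
    using exists_least_iff[of P] by blast
  then obtain l s where ls: "l \<in> {0, 1} \<times> UNIV" "magnus (\<psi> [l]) s n \<noteq> magnus [l] s n"
    unfolding P_def by blast
  have "n \<noteq> 0" using ls(2) by (cases n) auto
  define C where "C x = magnus (\<psi> [(x, True)]) s n - magnus [(x, True)] s n" for x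
  have step: "magnus (\<psi> w) s n = magnus w s n + (\<Sum>x\<in>{0, 1}. expsum w x * C x)"
    if "w \<in> carrier F2" for w
    unfolding C_def using n(2) \<open>n \<noteq> 0\<close> that
    by (intro magnus_hom[OF \<psi>]) (auto simp: P_def)
  have pow: "(\<psi> ^^ j) w \<in> carrier F2 \<and> expsum ((\<psi> ^^ j) w) x = expsum w x" if "w \<in> carrier F2" for w j x
  proof (induction j)
    case (Suc j)
    then show ?case using \<psi>_in[of "(\<psi> ^^ j) w"] expsum[of "(\<psi> ^^ j) w" x] by simp
  qed (use that in simp)
  have "magnus ((\<psi> ^^ j) w) s n = magnus w s n + int j * (\<Sum>x\<in>{0, 1}. expsum w x * C x)"
    if "w \<in> carrier F2" for w j
  proof (induction j)
    case (Suc j)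
    have "magnus ((\<psi> ^^ Suc j) w) s n =
        magnus ((\<psi> ^^ j) w) s n + (\<Sum>x\<in>{0, 1}. expsum w x * C x)"
      using step[of "(\<psi> ^^ j) w"] pow[OF that, of j] by simp
    then show ?case using Suc by (simp add: algebra_simps)
  qed simp
  moreover have "(\<Sum>x\<in>{0, 1}. expsum [l] x * C x) \<noteq> 0"
    using step[OF letter_in_F2[OF ls(1)]] ls(2) by auto
  ultimately show ?thesis using letter_in_F2[OF ls(1)] by blast
qed

lemma free_group_hom_eqI:
  assumes "\<phi> \<in> hom (free_group X) (free_group X)" "\<psi> \<in> hom (free_group X) (free_group X)"
    and "\<And>x. x \<in> X \<Longrightarrow> \<phi> [(x, True)] = \<psi> [(x, True)]" "w \<in> carrier (free_group X)"
  shows "\<phi> w = \<psi> w"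
proof -
  interpret F: group "free_group X" by (rule group_free_group)
  have "w \<in> words X" using assms(4) by (simp add: free_group_def)
  then have "word_value (free_group X) (\<lambda>x. \<phi> [(x, True)]) w =
      word_value (free_group X) (\<lambda>x. \<psi> [(x, True)]) w"
    using assms(3) by (induction w) (auto simp: words_def letter_value_def)
  then show ?thesis
    using F.free_group_hom_unique[OF assms(1,4)] F.free_group_hom_unique[OF assms(2,4)] by simp
qed

theorem power_bound:
  assumes \<phi>: "\<phi> \<in> hom F2 F2" "\<phi> ` carrier F2 = carrier F2"
    and small: "\<And>r x. r \<le> 12 \<Longrightarrow> x \<in> {0, 1} \<Longrightarrow> length ((\<phi> ^^ r) [(x, True)]) \<le> N"
    and target: "\<And>x. x \<in> {0, 1} \<Longrightarrow> length ((\<phi> ^^ k) [(x, True)]) \<le> N"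
  shows "\<exists>k'. k' < 48 * 2 ^ N \<and> (\<forall>w\<in>carrier F2. (\<phi> ^^ k') w = (\<phi> ^^ k) w)"
proof -
  note hom = funpow_hom[OF \<phi>(1)]
  have closed: "(\<phi> ^^ j) w \<in> carrier F2" if "w \<in> carrier F2" for j w
    using hom[of j] that by (auto simp: hom_def)
  have gen: "[(x, b)] \<in> carrier F2" if "x \<in> {0, 1}" for x b
    using that by (intro letter_in_F2) auto
  define e where "e j x s = expsum ((\<phi> ^^ j) [(x, True)]) s" for j x s
  have e_0: "e 0 x s = (if x = s then 1 else 0)" for x s
    by (simp add: e_def expsum_def letter_sign_def)
  have e_Suc: "e (Suc j) x s = e 1 x 0 * e j 0 s + e 1 x 1 * e j 1 s" if "x \<in> {0, 1}" for j x s
    using expsum_hom[OF hom[of j] closed[OF gen[OF that, of True], of 1], of s]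
    by (simp add: e_def funpow_swap1)
  define a b c d where "a = e 1 0 0" and "b = e 1 0 1" and "c = e 1 1 0" and "d = e 1 1 1"
  have det: "\<bar>a * d - b * c\<bar> = 1"
  proof -
    have "\<exists>w\<in>carrier F2. \<phi> w = [(x, True)]" if "x \<in> {0, 1}" for x
      using \<phi>(2) gen[OF that, of True] by (metis imageE)
    then obtain u v where uv: "u \<in> carrier F2" "\<phi> u = [(0, True)]" "v \<in> carrier F2" "\<phi> v = [(1, True)]"
      by (meson insertCI)
    have "expsum u 0 * a + expsum u 1 * c = 1" "expsum u 0 * b + expsum u 1 * d = 0"
      "expsum v 0 * a + expsum v 1 * c = 0" "expsum v 0 * b + expsum v 1 * d = 1"
      using expsum_hom[OF \<phi>(1) uv(1), of 0] expsum_hom[OF \<phi>(1) uv(1), of 1]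
        expsum_hom[OF \<phi>(1) uv(3), of 0] expsum_hom[OF \<phi>(1) uv(3), of 1]
      by (simp_all add: uv a_def b_def c_def d_def e_def expsum_def letter_sign_def)
    then have "(a * d - b * c) * (expsum u 0 * expsum v 1 - expsum u 1 * expsum v 0) = 1"
      by algebra
    then have "\<bar>(a * d - b * c) * (expsum u 0 * expsum v 1 - expsum u 1 * expsum v 0)\<bar> = 1"
      by (simp only: abs_one)
    then show ?thesis by (rule abs_zmult_eq_1)
  qed
  have rec: "\<forall>j. e (Suc j) 0 s = a * e j 0 s + b * e j 1 s \<and> e (Suc j) 1 s = c * e j 0 s + d * e j 1 s" for s
    unfolding a_def b_def c_def d_def by (intro allI conjI e_Suc) auto
  have N: "N < 2 ^ N" by simp
  have large: ?thesis if "int k - 1 \<le> \<bar>e k x s\<bar>" "x \<in> {0, 1}" for x s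
  proof -
    have "int k - 1 \<le> int N"
      using that abs_expsum_le[of "(\<phi> ^^ k) [(x, True)]" s] target[of x] by (simp add: e_def)
    then have "k < 48 * 2 ^ N" using N by linarith
    then show ?thesis by blast
  qed
  have periodic: ?thesis if e12: "\<And>s. e 12 0 s = e 0 0 s \<and> e 12 1 s = e 0 1 s"
  proof -
    define \<psi> where "\<psi> = \<phi> ^^ 12"
    have \<psi>: "\<psi> \<in> hom F2 F2" unfolding \<psi>_def by (rule hom)
    have expsum: "expsum (\<psi> w) s = expsum w s" if w: "w \<in> carrier F2" for w s
    proof (cases "s \<in> {0, 1}")
      case True
      then show ?thesis
        using expsum_hom[OF \<psi> w, of s] e12[of s] by (auto simp: e_def \<psi>_def expsum_def letter_sign_def)
    next
      case False
      then show ?thesis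
        using magnus_outside[of w "{0, 1}" s 0] magnus_outside[of "\<psi> w" "{0, 1}" s 0]
          w closed[OF w, of 12] by (simp add: magnus_1 free_group_def \<psi>_def)
    qed
    define q r where "q = k div 12" and "r = k mod 12"
    have r: "r < 12" "k = 12 * q + r" by (simp_all add: q_def r_def)
    have k: "(\<phi> ^^ k) w = (\<psi> ^^ q) ((\<phi> ^^ r) w)" for w
      unfolding r(2) by (simp add: funpow_add funpow_mult \<psi>_def)
    show ?thesis
    proof (cases "\<forall>x\<in>{0, 1}. \<psi> [(x, True)] = [(x, True)]")
      case True
      have "\<psi> w = w" if "w \<in> carrier F2" for w
        using free_group_hom_eqI[of \<psi> "{0, 1}" "\<lambda>w. w" w] \<psi> True that by (simp add: hom_def)
      then have "(\<psi> ^^ q) w = w" if "w \<in> carrier F2" for w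
        using that by (induction q) auto
      then have "(\<phi> ^^ r) w = (\<phi> ^^ k) w" if "w \<in> carrier F2" for w
        using k closed that by simp
      moreover have "r < 48 * 2 ^ N" using r(1) N by linarith
      ultimately show ?thesis by blast
    next
      case False
      then obtain x where x: "(x, True) \<in> {0, 1} \<times> UNIV" "\<psi> [(x, True)] \<noteq> [(x, True)]" by auto
      obtain n s C where
        lin: "\<And>w j. w \<in> carrier F2 \<Longrightarrow> magnus ((\<psi> ^^ j) w) s n =
          magnus w s n + int j * (\<Sum>x\<in>{0, 1}. expsum w x * C x)"
        and C: "\<exists>w\<in>carrier F2. (\<Sum>x\<in>{0, 1}. expsum w x * C x) \<noteq> 0"
        using magnus_funpow[OF \<psi> expsum x] by blast
      define T where "T w = (\<Sum>x\<in>{0, 1}. expsum w x * C x)" for w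
      have T: "T ((\<phi> ^^ r) w) = (\<Sum>x\<in>{0, 1}. expsum w x * T ((\<phi> ^^ r) [(x, True)]))"
        if "w \<in> carrier F2" for w
        unfolding T_def expsum_hom[OF hom that] by (simp add: algebra_simps)
      have "\<exists>x\<in>{0, 1}. T ((\<phi> ^^ r) [(x, True)]) \<noteq> 0"
      proof (rule ccontr)
        assume *: "\<not> ?thesis"
        obtain w where w: "w \<in> carrier F2" "T w \<noteq> 0"
          using C unfolding T_def by blast
        have "w \<in> (\<phi> ^^ r) ` carrier F2"
          using w(1) funpow_image[OF \<phi>(2), of r] by simp
        then obtain v where "v \<in> carrier F2" "w = (\<phi> ^^ r) v" by (rule imageE)
        then show False using w(2) T[of v] * by simp
      qed
      then obtain y where y: "y \<in> {0, 1}" "T ((\<phi> ^^ r) [(y, True)]) \<noteq> 0" by blast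
      let ?v = "(\<phi> ^^ r) [(y, True)]"
      have "int q * 1 \<le> int q * \<bar>T ?v\<bar>" using y(2) by (intro mult_left_mono) auto
      also have "\<dots> = \<bar>magnus ((\<phi> ^^ k) [(y, True)]) s n - magnus ?v s n\<bar>"
        using lin[OF closed[OF gen[OF y(1), of True], of r], of q] by (simp add: k T_def abs_mult)
      also have "\<dots> \<le> 2 ^ length ((\<phi> ^^ k) [(y, True)]) + 2 ^ length ?v"
        using abs_magnus_le[of "(\<phi> ^^ k) [(y, True)]" s n] abs_magnus_le[of ?v s n] by linarith
      also have "\<dots> \<le> 2 ^ N + 2 ^ N"
        using small[of r y] target[of y] r(1) y(1) by (intro add_mono power_increasing) auto
      finally have "int q \<le> int (2 * 2 ^ N)" by simp
      then have "k < 48 * 2 ^ N" using r N unfolding of_nat_le_iff by linarith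
      then show ?thesis by blast
    qed
  qed
  show ?thesis
  proof (rule matrix_powers[OF det], goal_cases)
    case 1
    show ?case by (rule periodic) (rule 1[OF rec])
  next
    case 2
    have "int k - 1 \<le> \<bar>e k 0 1\<bar>" by (rule 2[OF rec]) (simp_all add: e_0)
    then show ?case by (rule large) simp
  next
    case 3
    have "int k - 1 \<le> \<bar>e k 1 0\<bar>" by (rule 3[OF rec]) (simp_all add: e_0)
    then show ?case by (rule large) simp
  qed
qed

section \<open>The search program\<close>

declare fun_upd_apply [simp del] fun_upd_same [simp] fun_upd_other [simp]

lemma exec_untouched_same: "untouched q c \<Longrightarrow> exec c \<sigma> q = \<sigma> q"
  using exec_untouched[of q c \<sigma> "\<sigma> q"] by (metis fun_upd_same fun_upd_triv)

primrec pushes :: "nat \<Rightarrow> 's list \<Rightarrow> 's com" where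
  "pushes r [] = Skip"
| "pushes r (x # xs) = pushes r xs ;; Push r x"

definition transfer :: "nat \<Rightarrow> nat \<Rightarrow> 's com" where
  "transfer r q = Loop r (\<lambda>s. Push q s)"

text \<open>The command \<open>c\<close> runs while \<open>r\<close> is empty, and \<open>r\<close> is restored afterwards.\<close>

primrec when_eq :: "nat \<Rightarrow> 's list \<Rightarrow> 's com \<Rightarrow> 's com" where
  "when_eq r [] c = Case r (\<lambda>x. case x of None \<Rightarrow> c | Some s \<Rightarrow> Push r s)"
| "when_eq r (y # ys) c = Case r (\<lambda>x. case x of None \<Rightarrow> Skip
     | Some s \<Rightarrow> if s = y then when_eq r ys c ;; Push r s else Push r s)"

lemma exec_pushes: "exec (pushes r xs) \<sigma> = \<sigma>(r := xs @ \<sigma> r)"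
  by (induction xs) (auto simp: fun_eq_iff fun_upd_apply)

lemma exec_transfer:
  assumes "r \<noteq> q"
  shows "exec (transfer r q) \<sigma> = \<sigma>(r := [], q := rev (\<sigma> r) @ \<sigma> q)"
proof -
  have "fold (\<lambda>s. exec (Push q s)) xs \<sigma> = \<sigma>(q := rev xs @ \<sigma> q)" for xs \<sigma>
    by (induction xs arbitrary: \<sigma>) auto
  from this[of "\<sigma> r" "\<sigma>(r := [])"] assms show ?thesis
    unfolding transfer_def by (simp del: exec.simps add: exec.simps(5))
qed

lemma untouched_when_eq: "q \<noteq> r \<Longrightarrow> untouched q c \<Longrightarrow> untouched q (when_eq r ys c)"
  by (induction ys) (auto split: option.split)

lemma exec_when_eq:
  "untouched r c \<Longrightarrow> exec (when_eq r ys c) \<sigma> = (if \<sigma> r = ys then exec c \<sigma> else \<sigma>)"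
proof (induction ys arbitrary: \<sigma>)
  case (Cons y ys)
  show ?case
  proof (cases "\<sigma> r")
    case (Cons s xs)
    show ?thesis
      using Cons.IH[of "\<sigma>(r := xs)"] \<open>untouched r c\<close> exec_untouched[of r c \<sigma>] exec_untouched_same[of r c \<sigma>] Cons
      by (auto simp: fun_upd_idem)
  qed simp
qed (auto simp: fun_upd_idem split: list.split)

type_synonym sym = "nat letter option + nat"

abbreviation mark :: sym where "mark \<equiv> Inr 1"

definition enc :: "nat letter \<Rightarrow> sym" where
  "enc l = Inr (Suc (to_nat l))"

definition dec :: "sym \<Rightarrow> nat letter" where
  "dec = inv_into UNIV enc"

lemma enc_eq_iff [simp]: "enc l = enc m \<longleftrightarrow> l = m"
  by (simp add: enc_def)

lemma dec_enc [simp]: "dec (enc l) = l"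
  unfolding dec_def by (rule inv_f_f) (simp add: inj_def)

lemma map_enc_eq_iff [simp]: "map enc u = map enc v \<longleftrightarrow> u = v"
  by (simp add: inj_map_eq_map inj_def)

definition push_reduced :: "nat \<Rightarrow> nat letter \<Rightarrow> sym com" where
  "push_reduced r l = Case r (\<lambda>x. case x of None \<Rightarrow> Push r (enc l)
     | Some s \<Rightarrow> if s = enc (inv_letter l) then Skip else Push r s ;; Push r (enc l))"

primrec push_word :: "nat \<Rightarrow> nat letter list \<Rightarrow> sym com" where
  "push_word r [] = Skip"
| "push_word r (l # ls) = push_word r ls ;; push_reduced r l"

lemma exec_push_reduced:
  "\<sigma> r = map enc w \<Longrightarrow> exec (push_reduced r l) \<sigma> = \<sigma>(r := map enc (cons_reduce l w))"
  by (cases w) (auto simp: push_reduced_def)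

lemma exec_push_word:
  "\<sigma> r = map enc w \<Longrightarrow> exec (push_word r ls) \<sigma> = \<sigma>(r := map enc (foldr cons_reduce ls w))"
  by (induction ls) (auto simp: exec_push_reduced fun_upd_idem)

text \<open>
  The words \<open>u\<close> and \<open>v\<close> are stored in reverse, so that the automorphism to be applied first is on top.
  The registers \<open>r_log\<close>, \<open>r_bound\<close> and \<open>r_count\<close> hold unary numbers.
\<close>

abbreviation (input) "r_input \<equiv> 0 :: nat"
abbreviation (input) "r_u \<equiv> 1 :: nat"
abbreviation (input) "r_v \<equiv> 2 :: nat"
abbreviation (input) "r_sep \<equiv> 3 :: nat"
abbreviation (input) "r_inv_u \<equiv> 4 :: nat"
abbreviation (input) "r_img0 \<equiv> 5 :: nat"
abbreviation (input) "r_img1 \<equiv> 6 :: nat"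
abbreviation (input) "r_tmp \<equiv> 7 :: nat"
abbreviation (input) "r_log \<equiv> 8 :: nat"
abbreviation (input) "r_bound \<equiv> 9 :: nat"
abbreviation (input) "r_found \<equiv> 10 :: nat"
abbreviation (input) "r_save \<equiv> 11 :: nat"
abbreviation (input) "r_count \<equiv> 12 :: nat"

definition multiply :: "nat \<Rightarrow> nat \<Rightarrow> sym com" where
  "multiply n r = Loop r (\<lambda>s. pushes r_tmp (replicate n mark)) ;; transfer r_tmp r"

lemma exec_multiply:
  assumes "r \<noteq> r_tmp" "\<sigma> r_tmp = []" "\<sigma> r = replicate k mark"
  shows "exec (multiply n r) \<sigma> = \<sigma>(r := replicate (n * k) mark)"
proof -
  have "fold (\<lambda>s. exec (pushes r_tmp (replicate n mark))) xs \<sigma> =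
      \<sigma>(r_tmp := replicate (n * length xs) mark @ \<sigma> r_tmp)" for xs :: "sym list" and \<sigma>
    by (induction xs arbitrary: \<sigma>)
      (auto simp: exec_pushes fun_eq_iff fun_upd_apply replicate_add[symmetric] add.commute)
  from this[of "\<sigma> r" "\<sigma>(r := [])"] assms show ?thesis
    unfolding multiply_def exec.simps by (auto simp: exec_transfer fun_eq_iff fun_upd_apply)
qed

definition parse_symbol :: "nat \<Rightarrow> sym \<Rightarrow> sym com" where
  "parse_symbol K s = multiply K r_log ;;
     (case s of
        Inl (Some l) \<Rightarrow> Case r_sep (\<lambda>x. case x of None \<Rightarrow> Push r_u s
                          | Some m \<Rightarrow> Push r_sep m ;; Push r_v s)
      | Inl None \<Rightarrow> Push r_sep mark
      | Inr n \<Rightarrow> Skip)"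

abbreviation input_letter :: "nat letter \<Rightarrow> sym" where
  "input_letter l \<equiv> Inl (Some l)"

definition sym_letter :: "sym \<Rightarrow> nat letter" where
  "sym_letter s = (case s of Inl (Some l) \<Rightarrow> l | _ \<Rightarrow> (0, True))"

lemma parse_before_separator:
  assumes "\<sigma> r_tmp = []" "\<sigma> r_log = replicate n mark" "\<sigma> r_sep = []"
  shows "fold (\<lambda>s. exec (parse_symbol K s)) (map input_letter u) \<sigma> =
    \<sigma>(r_log := replicate (K ^ length u * n) mark, r_u := map input_letter (rev u) @ \<sigma> r_u)"
  using assms
proof (induction u arbitrary: \<sigma> n)
  case (Cons l u)
  let ?\<tau> = "\<sigma>(r_log := replicate (K * n) mark, r_u := input_letter l # \<sigma> r_u)"
  have "exec (parse_symbol K (input_letter l)) \<sigma> = ?\<tau>"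
    using Cons.prems exec_multiply[of r_log \<sigma> n K] by (simp add: parse_symbol_def)
  then show ?case
    using Cons.IH[of ?\<tau> "K * n"] Cons.prems by (simp add: fun_upd_twist mult_ac)
qed (auto simp: fun_upd_idem)

lemma parse_after_separator:
  assumes "\<sigma> r_tmp = []" "\<sigma> r_log = replicate n mark" "\<sigma> r_sep = [mark]"
  shows "fold (\<lambda>s. exec (parse_symbol K s)) (map input_letter v) \<sigma> =
    \<sigma>(r_log := replicate (K ^ length v * n) mark, r_v := map input_letter (rev v) @ \<sigma> r_v)"
  using assms
proof (induction v arbitrary: \<sigma> n)
  case (Cons l v)
  let ?\<tau> = "\<sigma>(r_log := replicate (K * n) mark, r_v := input_letter l # \<sigma> r_v)"
  have "exec (parse_symbol K (input_letter l)) \<sigma> = ?\<tau>"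
    using Cons.prems exec_multiply[of r_log \<sigma> n K] by (simp add: parse_symbol_def fun_eq_iff fun_upd_apply)
  then show ?case
    using Cons.IH[of ?\<tau> "K * n"] Cons.prems by (simp add: fun_upd_twist mult_ac)
qed (auto simp: fun_upd_idem)

lemma parse_separators:
  assumes "\<sigma> r_tmp = []" "\<sigma> r_log = replicate n mark"
  shows "length (fold (\<lambda>s. exec (parse_symbol K s)) (map Inl w) \<sigma> r_sep) =
      length (\<sigma> r_sep) + count_list w None"
    and "fold (\<lambda>s. exec (parse_symbol K s)) (map Inl w) \<sigma> r_found = \<sigma> r_found"
proof -
  have "length (fold (\<lambda>s. exec (parse_symbol K s)) (map Inl w) \<sigma> r_sep) =
      length (\<sigma> r_sep) + count_list w None \<and>
      fold (\<lambda>s. exec (parse_symbol K s)) (map Inl w) \<sigma> r_found = \<sigma> r_found"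
    using assms
  proof (induction w arbitrary: \<sigma> n)
    case (Cons x w)
    let ?\<tau> = "exec (parse_symbol K (Inl x)) \<sigma>"
    have "?\<tau> r_tmp = []" "?\<tau> r_log = replicate (K * n) mark" "?\<tau> r_found = \<sigma> r_found"
      "length (?\<tau> r_sep) = length (\<sigma> r_sep) + count_list [x] None"
      using Cons.prems exec_multiply[of r_log \<sigma> n K]
      by (auto simp: parse_symbol_def split: option.split list.split)
    with Cons.IH[of ?\<tau> "K * n"] show ?case by simp
  qed simp
  then show "length (fold (\<lambda>s. exec (parse_symbol K s)) (map Inl w) \<sigma> r_sep) =
      length (\<sigma> r_sep) + count_list w None"
    and "fold (\<lambda>s. exec (parse_symbol K s)) (map Inl w) \<sigma> r_found = \<sigma> r_found" by auto
qed

locale word_action =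
  fixes act :: "nat letter \<Rightarrow> nat letter \<Rightarrow> nat letter list"
begin

definition app :: "nat letter \<Rightarrow> nat letter list \<Rightarrow> nat letter list" where
  "app l w = reduce (concat (map (act l) w))"

definition app_word :: "nat letter list \<Rightarrow> nat letter list \<Rightarrow> nat letter list" where
  "app_word u w = foldr app u w"

definition apply_letter :: "nat letter \<Rightarrow> nat \<Rightarrow> sym com" where
  "apply_letter l r = transfer r r_tmp ;; Loop r_tmp (\<lambda>s. push_word r (act l (dec s)))"

lemma exec_apply_letter:
  assumes "r \<noteq> r_tmp" "\<sigma> r_tmp = []" "\<sigma> r = map enc w"
  shows "exec (apply_letter l r) \<sigma> = \<sigma>(r := map enc (app l w))"
proof -
  have "fold (\<lambda>s. exec (push_word r (act l (dec s)))) (rev (map enc w)) \<sigma> =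
      \<sigma>(r := map enc (app l w))" if "\<sigma> r = []" for \<sigma>
  proof (induction w)
    case (Cons m w)
    then show ?case
      using exec_push_word[of "\<sigma>(r := map enc (app l w))" r "app l w" "act l m"]
      by (simp add: app_def reduce_def)
  qed (use that in \<open>simp add: app_def reduce_def fun_upd_idem\<close>)
  with assms show ?thesis
    by (simp add: apply_letter_def exec_transfer rev_map fun_eq_iff fun_upd_apply)
qed

definition apply_word :: "nat \<Rightarrow> sym com" where
  "apply_word r = Loop r (\<lambda>s. Push r_save s ;; apply_letter (sym_letter s) r_img0 ;;
     apply_letter (sym_letter s) r_img1) ;; transfer r_save r"

definition images :: "(nat \<Rightarrow> sym list) \<Rightarrow> nat letter list \<times> nat letter list \<Rightarrow> nat \<Rightarrow> sym list" where
  "images \<sigma> p = \<sigma>(r_img0 := map enc (fst p), r_img1 := map enc (snd p))"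

lemma images_other: "r \<noteq> r_img0 \<Longrightarrow> r \<noteq> r_img1 \<Longrightarrow> images \<sigma> p r = \<sigma> r"
  by (simp add: images_def)

lemma images_update:
  "r \<noteq> r_img0 \<Longrightarrow> r \<noteq> r_img1 \<Longrightarrow> (images \<sigma> p)(r := xs) = images (\<sigma>(r := xs)) p"
  by (auto simp: images_def fun_eq_iff fun_upd_apply)

abbreviation app_pair :: "nat letter list \<Rightarrow> nat letter list \<times> nat letter list \<Rightarrow> nat letter list \<times> nat letter list" where
  "app_pair u \<equiv> map_prod (app_word u) (app_word u)"

lemma exec_apply_word:
  assumes r: "r \<notin> {r_img0, r_img1, r_tmp, r_save}" "\<sigma> r = map input_letter (rev u)"
    and "\<sigma> r_tmp = []" "\<sigma> r_save = []"
  shows "exec (apply_word r) (images \<sigma> p) = images \<sigma> (app_pair u p)"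
proof -
  obtain w w' where p: "p = (w, w')" by force
  have "fold (\<lambda>s. exec (Push r_save s ;; apply_letter (sym_letter s) r_img0 ;;
         apply_letter (sym_letter s) r_img1)) (map input_letter (rev u)) (images \<sigma> (w, w')) =
      images (\<sigma>(r_save := map input_letter u @ \<sigma> r_save)) (app_word u w, app_word u w')"
    if "\<sigma> r_tmp = []" for \<sigma>
  proof (induction u)
    case (Cons l u)
    let ?\<sigma> = "\<sigma>(r_save := map input_letter (l # u) @ \<sigma> r_save)"
    let ?v = "app_word u w" and ?v' = "app_word u w'"
    have "exec (apply_letter l r_img0) (images ?\<sigma> (?v, ?v')) = images ?\<sigma> (app l ?v, ?v')"
      using exec_apply_letter[of r_img0 "images ?\<sigma> (?v, ?v')" ?v l] that
      by (simp add: images_def fun_eq_iff fun_upd_apply)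
    moreover have "exec (apply_letter l r_img1) (images ?\<sigma> (app l ?v, ?v')) =
        images ?\<sigma> (app l ?v, app l ?v')"
      using exec_apply_letter[of r_img1 "images ?\<sigma> (app l ?v, ?v')" ?v' l] that
      by (simp add: images_def fun_eq_iff fun_upd_apply)
    ultimately show ?case
      using Cons by (simp add: sym_letter_def images_other images_update app_word_def)
  qed (simp add: app_word_def fun_upd_idem)
  from this[of "\<sigma>(r := [])"] show ?thesis
    using assms
    by (simp add: p apply_word_def images_other images_update exec_transfer rev_map fun_upd_idem)
qed

definition sym_inverse :: "sym \<Rightarrow> sym" where
  "sym_inverse s = (case s of Inl (Some l) \<Rightarrow> Inl (Some (inv_letter l)) | _ \<Rightarrow> s)"

text \<open>
  With \<open>both\<close>, the loop over \<open>r_bound\<close> replaces \<open>h\<close> by \<open>g\<^sup>B h\<close>, so that testing \<open>g\<^sup>B h = g\<^sup>i\<close> for \<open>i < 2 B\<close>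
  covers the exponents from \<open>- B\<close> to \<open>B - 1\<close>.
\<close>

definition search :: "bool \<Rightarrow> sym com" where
  "search both =
     Loop r_log (\<lambda>s. multiply 2 r_bound) ;;
     Loop r_u (\<lambda>s. Push r_save s ;; Push r_inv_u (sym_inverse s)) ;; transfer r_save r_u ;;
     Push r_img0 (enc (0, True)) ;; Push r_img1 (enc (1, True)) ;; apply_word r_v ;;
     Loop r_bound (\<lambda>s. pushes r_count [mark, mark] ;; (if both then apply_word r_u else Skip)) ;;
     Loop r_count (\<lambda>s.
       when_eq r_img0 [enc (0, True)] (when_eq r_img1 [enc (1, True)] (Push r_found mark)) ;;
       apply_word r_inv_u)"

definition orbit_program :: "nat \<Rightarrow> bool \<Rightarrow> sym com" where
  "orbit_program K both =
     Push r_log mark ;; pushes r_bound (replicate 48 mark) ;; Loop r_input (parse_symbol K) ;;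
     Case r_sep (\<lambda>x. case x of None \<Rightarrow> Skip
       | Some m \<Rightarrow> Case r_sep (\<lambda>y. case y of None \<Rightarrow> search both | Some m \<Rightarrow> Skip))"

abbreviation base :: "nat letter list \<times> nat letter list" where
  "base \<equiv> ([(0, True)], [(1, True)])"

lemma exec_bound_loop:
  "\<sigma> r_tmp = [] \<Longrightarrow> \<sigma> r_bound = replicate m mark \<Longrightarrow>
   fold (\<lambda>s. exec (multiply 2 r_bound)) xs \<sigma> = \<sigma>(r_bound := replicate (2 ^ length xs * m) mark)"
proof (induction xs arbitrary: \<sigma> m)
  case (Cons x xs)
  then show ?case
    using Cons.IH[of "\<sigma>(r_bound := replicate (2 * m) mark)" "2 * m"] exec_multiply[of r_bound \<sigma> m 2]
    by (simp add: mult_ac)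
qed (simp add: fun_upd_idem)

lemma exec_inverse_loop:
  "fold (\<lambda>s. exec (Push r_save s ;; Push r_inv_u (sym_inverse s))) xs \<sigma> =
   \<sigma>(r_save := rev xs @ \<sigma> r_save, r_inv_u := rev (map sym_inverse xs) @ \<sigma> r_inv_u)"
  by (induction xs arbitrary: \<sigma>) (auto simp: fun_eq_iff fun_upd_apply)

lemma exec_count_loop:
  assumes "\<sigma> r_u = map input_letter (rev u)" "\<sigma> r_tmp = []" "\<sigma> r_save = []"
  shows "fold (\<lambda>s. exec (pushes r_count [mark, mark] ;; (if both then apply_word r_u else Skip))) xs
      (images \<sigma> p) =
    images (\<sigma>(r_count := replicate (2 * length xs) mark @ \<sigma> r_count))
      ((app_pair u ^^ (if both then length xs else 0)) p)"
  using assms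
proof (induction xs arbitrary: \<sigma> p)
  case (Cons x xs)
  let ?\<tau> = "\<sigma>(r_count := mark # mark # \<sigma> r_count)"
  let ?p = "(app_pair u ^^ (if both then 1 else 0)) p"
  have "exec (pushes r_count [mark, mark] ;; (if both then apply_word r_u else Skip)) (images \<sigma> p) =
      images ?\<tau> ?p"
    using exec_apply_word[of r_u ?\<tau> u p] Cons.prems
    by (simp add: images_other images_update)
  then show ?case
    using Cons.IH[of ?\<tau> ?p] Cons.prems
    by (cases both) (simp_all add: funpow_swap1 replicate_app_Cons_same)
qed (simp add: fun_upd_idem)

lemma exec_test_loop:
  assumes "\<sigma> r_inv_u = map input_letter (rev u)" "\<sigma> r_tmp = []" "\<sigma> r_save = []"
  defines "test \<equiv> when_eq r_img0 [enc (0, True)] (when_eq r_img1 [enc (1, True)] (Push r_found mark)) ;;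
    apply_word r_inv_u"
  shows "fold (\<lambda>s. exec test) xs (images \<sigma> p) r_found \<noteq> [] \<longleftrightarrow>
    \<sigma> r_found \<noteq> [] \<or> (\<exists>i<length xs. (app_pair u ^^ i) p = base)"
  using assms(1-3)
proof (induction xs arbitrary: \<sigma> p)
  case (Cons x xs)
  let ?\<tau> = "\<sigma>(r_found := if p = base then mark # \<sigma> r_found else \<sigma> r_found)"
  have "exec (when_eq r_img0 [enc (0, True)] (when_eq r_img1 [enc (1, True)] (Push r_found mark)))
      (images \<sigma> p) = images ?\<tau> p"
    by (cases p) (auto simp: exec_when_eq untouched_when_eq images_def fun_eq_iff fun_upd_apply simp del: when_eq.simps)
  then have "exec test (images \<sigma> p) = images ?\<tau> (app_pair u p)"
    using exec_apply_word[of r_inv_u ?\<tau> u p] Cons.prems by (simp add: test_def del: when_eq.simps)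
  then have "fold (\<lambda>s. exec test) (x # xs) (images \<sigma> p) r_found \<noteq> [] \<longleftrightarrow>
      \<sigma> r_found \<noteq> [] \<or> p = base \<or> (\<exists>i<length xs. (app_pair u ^^ Suc i) p = base)"
    using Cons.IH[of ?\<tau> "app_pair u p"] Cons.prems by (simp add: funpow_swap1)
  then show ?case by (auto simp: less_Suc_eq_0_disj)
qed (simp add: images_other)

lemma exec_search:
  assumes regs: "\<sigma> r_u = map input_letter (rev u)" "\<sigma> r_v = map input_letter (rev v)"
      "\<sigma> r_log = replicate n mark" "\<sigma> r_bound = replicate m mark"
    and empty: "\<sigma> r_inv_u = []" "\<sigma> r_img0 = []" "\<sigma> r_img1 = []" "\<sigma> r_tmp = []"
      "\<sigma> r_found = []" "\<sigma> r_save = []" "\<sigma> r_count = []"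
  defines "B \<equiv> 2 ^ n * m"
  shows "exec (search both) \<sigma> r_found \<noteq> [] \<longleftrightarrow>
    (\<exists>i<2 * B. (app_pair (rev (map inv_letter u)) ^^ i)
       ((app_pair u ^^ (if both then B else 0)) (app_pair v base)) = base)"
proof -
  let ?test = "when_eq r_img0 [enc (0, True)] (when_eq r_img1 [enc (1, True)] (Push r_found mark)) ;;
    apply_word r_inv_u"
  let ?u' = "rev (map inv_letter u)"
  let ?\<sigma>1 = "\<sigma>(r_log := [], r_bound := replicate B mark)"
  let ?\<sigma>2 = "?\<sigma>1(r_inv_u := map input_letter (rev ?u'))"
  let ?p = "(app_pair u ^^ (if both then B else 0)) (app_pair v base)"
  have 1: "exec (Loop r_log (\<lambda>s. multiply 2 r_bound)) \<sigma> = ?\<sigma>1"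
    using exec_bound_loop[of "\<sigma>(r_log := [])" m "replicate n mark"] regs empty
    by (simp add: B_def)
  have "map sym_inverse (map input_letter (rev u)) = map input_letter (rev (map inv_letter u))"
    by (simp add: sym_inverse_def rev_map)
  then have 2: "exec (transfer r_save r_u)
      (exec (Loop r_u (\<lambda>s. Push r_save s ;; Push r_inv_u (sym_inverse s))) ?\<sigma>1) = ?\<sigma>2"
    using regs empty
    by (simp del: exec.simps(1-4) add: exec_inverse_loop exec_transfer rev_map)
      (auto simp: fun_eq_iff fun_upd_apply rev_map)
  have 3: "exec (apply_word r_v) (exec (Push r_img1 (enc (1, True))) (exec (Push r_img0 (enc (0, True))) ?\<sigma>2)) =
      images ?\<sigma>2 (app_pair v base)"
  proof -
    have "exec (Push r_img1 (enc (1, True))) (exec (Push r_img0 (enc (0, True))) ?\<sigma>2) = images ?\<sigma>2 base"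
      using empty by (simp add: images_def)
    then show ?thesis using exec_apply_word[of r_v ?\<sigma>2 v base] regs empty by simp
  qed
  let ?\<sigma>3 = "?\<sigma>2(r_bound := [], r_count := replicate (2 * B) mark)"
  have 4: "exec (Loop r_bound (\<lambda>s. pushes r_count [mark, mark] ;; (if both then apply_word r_u else Skip)))
      (images ?\<sigma>2 (app_pair v base)) = images ?\<sigma>3 ?p"
    using exec_count_loop[of "?\<sigma>2(r_bound := [])" u both "replicate B mark" "app_pair v base"] regs empty
    by (simp del: exec.simps(1-4) pushes.simps add: images_other images_update)
  have "exec (Loop r_count (\<lambda>s. ?test)) (images ?\<sigma>3 ?p) r_found \<noteq> [] \<longleftrightarrow>
      (\<exists>i<2 * B. (app_pair ?u' ^^ i) ?p = base)"
    using exec_test_loop[of "?\<sigma>3(r_count := [])" ?u' "replicate (2 * B) mark" ?p] regs empty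
    by (simp del: exec.simps(1-4) when_eq.simps add: images_other images_update)
  then show ?thesis
    unfolding search_def exec.simps(3) 1 2 3 4 .
qed

lemma encode_pair_inject: "encode_pair u v = encode_pair u' v' \<longleftrightarrow> u = u' \<and> v = v'"
  by (auto simp: encode_pair_def append_Cons_eq_iff inj_map_eq_map)

lemma encode_pair_iff: "(\<exists>u v. w = encode_pair u v) \<longleftrightarrow> count_list w None = 1"
proof
  assume "\<exists>u v. w = encode_pair u v"
  then show "count_list w None = 1" by (auto simp: encode_pair_def)
next
  assume *: "count_list w None = 1"
  then have "None \<in> set w" by (metis count_notin zero_neq_one)
  then obtain a c where w: "w = a @ None # c" by (meson split_list)
  with * have "None \<notin> set a" "None \<notin> set c" by (auto simp: count_list_0_iff)
  then have "Some (the x) = x" if "x \<in> set a \<union> set c" for x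
    using that by (cases x) auto
  then have "map (\<lambda>x. Some (the x)) a = a" "map (\<lambda>x. Some (the x)) c = c"
    by (auto intro: map_idI)
  with w have "w = encode_pair (map the a) (map the c)" by (simp add: encode_pair_def comp_def)
  then show "\<exists>u v. w = encode_pair u v" by blast
qed

lemma exec_orbit_program:
  fixes w :: "nat letter option list" and K :: nat
  defines "B \<equiv> 48 * 2 ^ (K ^ length w)"
  shows "exec (orbit_program K both) ((\<lambda>r. [])(0 := map Inl w)) r_found \<noteq> [] \<longleftrightarrow>
    (\<exists>u v. w = encode_pair u v \<and> (\<exists>i < 2 * B.
       (app_pair (rev (map inv_letter u)) ^^ i)
         ((app_pair u ^^ (if both then B else 0)) (app_pair v base)) = base))"
proof -
  let ?in = "(\<lambda>r. [])(0 := map Inl w) :: nat \<Rightarrow> sym list"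
  let ?\<sigma> = "(\<lambda>r. [])(r_log := [mark], r_bound := replicate 48 mark) :: nat \<Rightarrow> sym list"
  define \<tau> where "\<tau> = fold (\<lambda>s. exec (parse_symbol K s)) (map Inl w) ?\<sigma>"
  have prog: "exec (orbit_program K both) ?in =
      (case \<tau> r_sep of [m] \<Rightarrow> exec (search both) (\<tau>(r_sep := [])) | [] \<Rightarrow> \<tau> | m # m' # ms \<Rightarrow> \<tau>(r_sep := ms))"
  proof -
    have "?in(r_log := [mark], r_bound := replicate 48 mark, 0 := []) = ?\<sigma>"
      by (auto simp: fun_eq_iff fun_upd_apply)
    then show ?thesis
      by (simp add: orbit_program_def exec_pushes \<tau>_def fun_upd_twist split: list.split)
  qed
  have sep: "length (\<tau> r_sep) = count_list w None" "\<tau> r_found = []"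
    using parse_separators[of ?\<sigma> 1 K w] by (simp_all add: \<tau>_def)
  show ?thesis
  proof (cases "\<exists>u v. w = encode_pair u v")
    case True
    then obtain u v where w: "w = encode_pair u v" by blast
    let ?n = "K ^ length w"
    have "\<tau> = ?\<sigma>(r_log := replicate ?n mark, r_u := map input_letter (rev u),
        r_v := map input_letter (rev v), r_sep := [mark])"
    proof -
      let ?a = "?\<sigma>(r_log := replicate (K ^ length u) mark, r_u := map input_letter (rev u))"
      let ?b = "?a(r_log := replicate (K * K ^ length u) mark, r_sep := [mark])"
      have 1: "fold (\<lambda>s. exec (parse_symbol K s)) (map input_letter u) ?\<sigma> = ?a"
        using parse_before_separator[of ?\<sigma> 1 K u] by simp
      have 2: "exec (parse_symbol K (Inl None)) ?a = ?b"
        using exec_multiply[of r_log ?a "K ^ length u" K] by (simp add: parse_symbol_def)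
      have 3: "fold (\<lambda>s. exec (parse_symbol K s)) (map input_letter v) ?b =
          ?b(r_log := replicate (K ^ length v * (K * K ^ length u)) mark, r_v := map input_letter (rev v))"
        using parse_after_separator[of ?b "K * K ^ length u" K v] by simp
      have "\<tau> = fold (\<lambda>s. exec (parse_symbol K s)) (map input_letter v)
          (exec (parse_symbol K (Inl None))
            (fold (\<lambda>s. exec (parse_symbol K s)) (map input_letter u) ?\<sigma>))"
        by (simp add: \<tau>_def w encode_pair_def comp_def)
      then have "\<tau> = ?b(r_log := replicate (K ^ length v * (K * K ^ length u)) mark,
          r_v := map input_letter (rev v))"
        unfolding 1 2 3 .
      moreover have "K ^ length v * (K * K ^ length u) = ?n"
        by (simp add: w encode_pair_def power_add)
      ultimately show ?thesis by (auto simp: fun_eq_iff fun_upd_apply)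
    qed
    then have "exec (orbit_program K both) ?in = exec (search both) (?\<sigma>(r_log := replicate ?n mark,
        r_u := map input_letter (rev u), r_v := map input_letter (rev v)))"
      by (simp add: prog) (simp add: fun_upd_twist fun_upd_idem)
    moreover have "(\<exists>u' v'. w = encode_pair u' v' \<and> P u' v') \<longleftrightarrow> P u v" for P
      by (auto simp: w encode_pair_inject)
    ultimately show ?thesis
      using exec_search[of "?\<sigma>(r_log := replicate ?n mark, r_u := map input_letter (rev u),
        r_v := map input_letter (rev v))" u v ?n 48 both]
      by (simp add: B_def mult.commute)
  next
    case False
    then have "length (\<tau> r_sep) \<noteq> 1"
      using sep(1) by (simp add: encode_pair_iff)
    then have "exec (orbit_program K both) ?in r_found = []"
      using sep(2) by (auto simp: prog split: list.split)
    with False show ?thesis by simp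
  qed
qed

lemma untouched_program_parts:
  "q \<noteq> r \<Longrightarrow> untouched q (pushes r xs)"
  "q \<noteq> r \<Longrightarrow> q \<noteq> p \<Longrightarrow> untouched q (transfer r p)"
  "q \<noteq> r \<Longrightarrow> q \<noteq> r_tmp \<Longrightarrow> untouched q (multiply n r)"
  "q \<noteq> r \<Longrightarrow> untouched q (push_word r ls)"
  "q \<noteq> r \<Longrightarrow> q \<noteq> r_tmp \<Longrightarrow> untouched q (apply_letter l r)"
  "q \<notin> {r, r_img0, r_img1, r_tmp, r_save} \<Longrightarrow> untouched q (apply_word r)"
proof -
  show pushes: "q \<noteq> r \<Longrightarrow> untouched q (pushes r xs)" for q r xs
    by (induction xs) auto
  show transfer: "q \<noteq> r \<Longrightarrow> q \<noteq> p \<Longrightarrow> untouched q (transfer r p)" for q r p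
    by (simp add: transfer_def)
  show "q \<noteq> r \<Longrightarrow> q \<noteq> r_tmp \<Longrightarrow> untouched q (multiply n r)"
    by (simp add: multiply_def pushes transfer)
  show push_word: "q \<noteq> r \<Longrightarrow> untouched q (push_word r ls)" for q r ls
    by (induction ls) (auto simp: push_reduced_def split: option.split)
  show letter: "q \<noteq> r \<Longrightarrow> q \<noteq> r_tmp \<Longrightarrow> untouched q (apply_letter l r)" for q r l
    by (simp add: apply_letter_def transfer push_word)
  show "q \<notin> {r, r_img0, r_img1, r_tmp, r_save} \<Longrightarrow> untouched q (apply_word r)"
    by (simp add: apply_word_def letter transfer)
qed

lemma wf_orbit_program:
  assumes mark: "mark \<in> S" and enc: "enc ` ({0, 1} \<times> UNIV) \<subseteq> S"
    and inverse: "\<And>l. input_letter l \<in> S \<Longrightarrow> input_letter (inv_letter l) \<in> S"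
    and act: "\<And>l m. act l m \<in> words {0, 1}"
  shows "wf_com 13 S (orbit_program K both)"
proof -
  have pushes: "r < 13 \<Longrightarrow> set xs \<subseteq> S \<Longrightarrow> wf_com 13 S (pushes r xs)" for r and xs :: "sym list"
    by (induction xs) auto
  have transfer: "r < 13 \<Longrightarrow> p < 13 \<Longrightarrow> r \<noteq> p \<Longrightarrow> wf_com 13 S (transfer r p)" for r p
    by (simp add: transfer_def)
  have multiply: "r < 13 \<Longrightarrow> r \<noteq> r_tmp \<Longrightarrow> wf_com 13 S (multiply n r)" for r n
    using mark by (auto simp: multiply_def transfer untouched_program_parts intro!: pushes)
  have push_word: "r < 13 \<Longrightarrow> ls \<in> words {0, 1} \<Longrightarrow> wf_com 13 S (push_word r ls)" for r ls
  proof (induction ls)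
    case (Cons l ls)
    then have "enc l \<in> S" "ls \<in> words {0, 1}" using enc by (auto simp: words_def)
    with Cons show ?case by (auto simp: push_reduced_def)
  qed simp
  have apply_letter: "r < 13 \<Longrightarrow> r \<noteq> r_tmp \<Longrightarrow> wf_com 13 S (apply_letter l r)" for r l
    using act by (simp add: apply_letter_def transfer push_word untouched_program_parts)
  have apply_word: "wf_com 13 S (apply_word r)" if "r < 13" "r \<notin> {r_img0, r_img1, r_tmp, r_save}" for r
    using that by (simp add: apply_word_def apply_letter transfer untouched_program_parts)
  have parse: "wf_com 13 S (parse_symbol K s)" if "s \<in> S" for s
    using that mark by (auto simp: parse_symbol_def multiply split: sum.split option.split)
  have parse': "untouched r_input (parse_symbol K s)" for s
    by (auto simp: parse_symbol_def untouched_program_parts split: sum.split option.split)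
  have inverse: "sym_inverse s \<in> S" if "s \<in> S" for s
    using that inverse by (auto simp: sym_inverse_def split: sum.split option.split)
  have gens: "enc (0, True) \<in> S" "enc (Suc 0, True) \<in> S" using enc by auto
  have "wf_com 13 S (search both)"
    using mark gens
    by (auto simp: search_def multiply transfer apply_word inverse untouched_program_parts untouched_when_eq
        simp del: when_eq.simps)
      (auto split: option.split)
  then show ?thesis
    using mark by (auto simp: orbit_program_def parse parse' intro!: pushes)
qed

end

section \<open>Automorphisms given by words\<close>

declare One_nat_def [simp del]

lemma length_reduce_le: "length (reduce w) \<le> length w"
proof (induction w)
  case (Cons l w)
  have "length (cons_reduce l v) \<le> Suc (length v)" for v
    by (cases v) auto
  from this[of "reduce w"] Cons show ?case by (simp add: reduce_def)
qed (simp add: reduce_def)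

locale generated_automorphisms =
  fixes gs :: "(nat letter list \<Rightarrow> nat letter list) list"
  assumes gs: "set gs \<subseteq> carrier (AutoGroup F2)"
begin

abbreviation "G \<equiv> AutoGroup F2"
abbreviation "val \<equiv> word_value G ((!) gs)"

sublocale F: group F2
  by (rule group_free_group)

sublocale G: group G
  by (rule F.AutoGroup)

lemma carrier_G:
  assumes "x \<in> carrier G"
  shows "x \<in> hom F2 F2" "x \<in> extensional (carrier F2)" "bij_betw x (carrier F2) (carrier F2)"
    "w \<in> carrier F2 \<Longrightarrow> x w \<in> carrier F2"
  using assms by (auto simp: AutoGroup_def auto_def Bij_def hom_def)

lemma mult_G: "x \<in> carrier G \<Longrightarrow> y \<in> carrier G \<Longrightarrow> w \<in> carrier F2 \<Longrightarrow> (x \<otimes>\<^bsub>G\<^esub> y) w = x (y w)"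
  by (simp add: AutoGroup_def BijGroup_def auto_def compose_def)

lemma one_G: "w \<in> carrier F2 \<Longrightarrow> \<one>\<^bsub>G\<^esub> w = w"
  by (simp add: AutoGroup_def BijGroup_def)

lemma pow_G: "x \<in> carrier G \<Longrightarrow> w \<in> carrier F2 \<Longrightarrow> (x [^]\<^bsub>G\<^esub> (k :: nat)) w = (x ^^ k) w"
  by (induction k arbitrary: w) (simp_all add: one_G mult_G carrier_G funpow_swap1)

lemma gens_in_F2: "[(0, True)] \<in> carrier F2" "[(1, True)] \<in> carrier F2"
  by (auto intro!: letter_in_F2)

lemma G_eqI:
  assumes "x \<in> carrier G" "y \<in> carrier G" "x [(0, True)] = y [(0, True)]" "x [(1, True)] = y [(1, True)]"
  shows "x = y"
proof (rule extensionalityI[OF carrier_G(2)[OF assms(1)] carrier_G(2)[OF assms(2)]])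
  fix w assume w: "w \<in> carrier F2"
  have "x [(i, True)] = y [(i, True)]" if "i \<in> {0, 1}" for i
    using that assms(3,4) by auto
  from free_group_hom_eqI[OF carrier_G(1)[OF assms(1)] carrier_G(1)[OF assms(2)] this w]
  show "x w = y w" .
qed

lemma gs_Pi: "(!) gs \<in> {..<length gs} \<rightarrow> carrier G"
  using gs by auto

lemma val_closed: "u \<in> words {..<length gs} \<Longrightarrow> val u \<in> carrier G"
  by (rule G.word_value_closed[OF gs_Pi])

lemma val_inverse:
  assumes "u \<in> words {..<length gs}"
  shows "rev (map inv_letter u) \<in> words {..<length gs}" "val (rev (map inv_letter u)) = inv\<^bsub>G\<^esub> (val u)"
proof -
  show u': "rev (map inv_letter u) \<in> words {..<length gs}"
    using assms by (auto simp: words_def inv_letter_def lists_eq_set)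
  then have "rev (map inv_letter u) @ u \<in> words {..<length gs}"
    using assms by (simp add: words_def)
  then have "val (rev (map inv_letter u) @ u) = \<one>\<^bsub>G\<^esub>"
    using G.word_value_reduce[OF gs_Pi, of "rev (map inv_letter u) @ u"] by (simp add: reduce_inverse)
  then show "val (rev (map inv_letter u)) = inv\<^bsub>G\<^esub> (val u)"
    using G.word_value_append[OF gs_Pi u' assms] u' assms
    by (metis G.inv_equality val_closed)
qed

definition act :: "nat letter \<Rightarrow> nat letter \<Rightarrow> nat letter list" where
  "act l m = (if l \<in> {..<length gs} \<times> UNIV \<and> m \<in> {0, 1} \<times> UNIV then letter_value G ((!) gs) l [m] else [])"

sublocale word_action act .

lemma letter_value_G: "l \<in> {..<length gs} \<times> UNIV \<Longrightarrow> letter_value G ((!) gs) l \<in> carrier G"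
  by (rule G.letter_value_closed[OF gs_Pi])

lemma act_in_words: "act l m \<in> words {0, 1}"
proof (cases "l \<in> {..<length gs} \<times> UNIV \<and> m \<in> {0, 1} \<times> UNIV")
  case True
  then have "letter_value G ((!) gs) l [m] \<in> carrier F2"
    using letter_value_G carrier_G(4) letter_in_F2 by blast
  with True show ?thesis by (simp add: act_def free_group_def)
next
  case False
  then show ?thesis by (auto simp: act_def words_def)
qed

lemma act_bounded: "\<exists>K\<ge>1. \<forall>l m. length (act l m) \<le> K"
proof -
  let ?S = "(\<lambda>(l, m). length (act l m)) ` (({..<length gs} \<times> UNIV) \<times> ({0, 1} \<times> UNIV))"
  have "length (act l m) \<le> Suc (Max ?S)" for l m
  proof (cases "l \<in> {..<length gs} \<times> UNIV \<and> m \<in> {0, 1} \<times> UNIV")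
    case True
    then have "length (act l m) \<in> ?S" by force
    then have "length (act l m) \<le> Max ?S" by (intro Max_ge) auto
    then show ?thesis by simp
  next
    case False
    then show ?thesis by (auto simp: act_def)
  qed
  then show ?thesis by (intro exI[of _ "Suc (Max ?S)"]) auto
qed

lemma app_letter_value:
  assumes "l \<in> {..<length gs} \<times> UNIV" "w \<in> carrier F2"
  shows "app l w = letter_value G ((!) gs) l w"
proof -
  have "map (act l) w = map (\<lambda>m. letter_value G ((!) gs) l [m]) w"
    using assms by (intro map_cong) (auto simp: act_def free_group_def words_def)
  then have "app l w = reduce (concat (map (\<lambda>m. letter_value G ((!) gs) l [m]) w))"
    by (simp only: app_def)
  also have "\<dots> = letter_value G ((!) gs) l w"
    by (rule hom_free_group_reduce[OF carrier_G(1)[OF letter_value_G[OF assms(1)]] assms(2), symmetric])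
  finally show ?thesis .
qed

lemma app_word_val:
  assumes "u \<in> words {..<length gs}" "w \<in> carrier F2"
  shows "app_word u w = val u w"
  using assms(1)
proof (induction u)
  case Nil
  then show ?case using assms(2) by (simp add: app_word_def one_G)
next
  case (Cons l u)
  then have lu: "l \<in> {..<length gs} \<times> UNIV" "u \<in> words {..<length gs}" by (auto simp: words_def)
  have "app_word (l # u) w = app l (val u w)"
    using Cons.IH[OF lu(2)] by (simp add: app_word_def)
  also have "\<dots> = val (l # u) w"
    using lu assms(2) by (simp add: app_letter_value carrier_G(4) val_closed mult_G letter_value_G)
  finally show ?case .
qed

lemma length_app_word_le:
  assumes "\<And>l m. length (act l m) \<le> K"
  shows "length (app_word u w) \<le> K ^ length u * length w"
proof (induction u)
  case (Cons l u)
  have "length (concat (map (act l) v)) \<le> K * length v" for v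
    by (induction v) (simp_all add: add_mono assms)
  then have "length (app l (app_word u w)) \<le> K * length (app_word u w)"
    unfolding app_def using length_reduce_le le_trans by blast
  also have "\<dots> \<le> K * (K ^ length u * length w)"
    using Cons by (intro mult_left_mono) auto
  finally show ?case by (simp add: app_word_def)
qed (simp add: app_word_def)

definition gen_images :: "(nat letter list \<Rightarrow> nat letter list) \<Rightarrow> nat letter list \<times> nat letter list" where
  "gen_images x = (x [(0, True)], x [(1, True)])"

lemma gen_images_inject:
  "x \<in> carrier G \<Longrightarrow> y \<in> carrier G \<Longrightarrow> gen_images x = gen_images y \<longleftrightarrow> x = y"
  using G_eqI by (auto simp: gen_images_def)

lemma base_gen_images: "base = gen_images \<one>\<^bsub>G\<^esub>"
  using gens_in_F2 by (simp add: gen_images_def one_G)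

lemma app_pair_gen_images:
  assumes "u \<in> words {..<length gs}" "x \<in> carrier G"
  shows "app_pair u (gen_images x) = gen_images (val u \<otimes>\<^bsub>G\<^esub> x)"
  using app_word_val[OF assms(1)] mult_G[OF val_closed[OF assms(1)] assms(2)] carrier_G(4)[OF assms(2)] gens_in_F2
  by (simp add: gen_images_def)

lemma app_pair_funpow_gen_images:
  assumes "u \<in> words {..<length gs}" "x \<in> carrier G"
  shows "(app_pair u ^^ i) (gen_images x) = gen_images (val u [^]\<^bsub>G\<^esub> i \<otimes>\<^bsub>G\<^esub> x)"
proof (induction i)
  case (Suc i)
  have g: "val u \<in> carrier G" by (rule val_closed[OF assms(1)])
  have "(app_pair u ^^ Suc i) (gen_images x) = gen_images (val u \<otimes>\<^bsub>G\<^esub> (val u [^]\<^bsub>G\<^esub> i \<otimes>\<^bsub>G\<^esub> x))"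
    using Suc app_pair_gen_images[OF assms(1)] g assms(2) by simp
  also have "val u \<otimes>\<^bsub>G\<^esub> (val u [^]\<^bsub>G\<^esub> i \<otimes>\<^bsub>G\<^esub> x) = val u [^]\<^bsub>G\<^esub> Suc i \<otimes>\<^bsub>G\<^esub> x"
    using g assms(2) G.nat_pow_Suc2[OF g] by (simp add: G.m_assoc)
  finally show ?case .
qed (use assms in simp)

lemma power_bound_words:
  assumes K: "\<And>l m. length (act l m) \<le> K" "1 \<le> K"
    and u: "u \<in> words {..<length gs}" and v: "v \<in> words {..<length gs}"
    and k: "val u [^]\<^bsub>G\<^esub> (k :: nat) = val v" and n: "length u + length v \<le> n"
  shows "\<exists>k' < (48 * 2 ^ ((K ^ 12) ^ n) :: nat). val u [^]\<^bsub>G\<^esub> k' = val v"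
proof -
  let ?\<phi> = "val u" and ?N = "(K ^ 12) ^ n"
  have g: "?\<phi> \<in> carrier G" using u by (rule val_closed)
  have small: "length ((?\<phi> ^^ r) w) \<le> (K ^ length u) ^ r * length w" if "w \<in> carrier F2" for r w
  proof (induction r)
    case (Suc r)
    have "(?\<phi> ^^ r) w \<in> carrier F2"
      using pow_G[OF g that, of r] carrier_G(4)[OF G.nat_pow_closed[OF g] that, of r] by simp
    then have "length ((?\<phi> ^^ Suc r) w) \<le> K ^ length u * length ((?\<phi> ^^ r) w)"
      using length_app_word_le[OF K(1), of u "(?\<phi> ^^ r) w"] app_word_val[OF u] by simp
    also have "\<dots> \<le> K ^ length u * ((K ^ length u) ^ r * length w)"
      using Suc by (intro mult_left_mono) auto
    finally show ?case by (simp add: mult_ac)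
  qed simp
  have gen: "[(x, True)] \<in> carrier F2" if "x \<in> {0, 1}" for x
    using that by (intro letter_in_F2) auto
  have "\<exists>k' < 48 * 2 ^ ?N. \<forall>w\<in>carrier F2. (?\<phi> ^^ k') w = (?\<phi> ^^ k) w"
  proof (rule power_bound)
    show "?\<phi> \<in> hom F2 F2" "?\<phi> ` carrier F2 = carrier F2"
      using carrier_G(1,3)[OF g] by (auto simp: bij_betw_def)
  next
    fix r x :: nat assume "r \<le> 12" "x \<in> {0, 1}"
    then have "length ((?\<phi> ^^ r) [(x, True)]) \<le> K ^ (length u * r)"
      using small[OF gen, of x r] by (simp add: power_mult)
    also have "\<dots> \<le> K ^ (12 * n)"
      using n \<open>r \<le> 12\<close> K(2) mult_le_mono[of "length u" n r 12]
      by (intro power_increasing) (auto simp: mult.commute)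
    finally show "length ((?\<phi> ^^ r) [(x, True)]) \<le> ?N" by (simp add: power_mult)
  next
    fix x :: nat assume x: "x \<in> {0, 1}"
    have "length ((?\<phi> ^^ k) [(x, True)]) \<le> K ^ length v"
      using length_app_word_le[OF K(1), of v "[(x, True)]"] app_word_val[OF v gen[OF x]]
        pow_G[OF g gen[OF x], of k] k by simp
    also have "\<dots> \<le> K ^ (12 * n)"
      using n K(2) by (intro power_increasing) auto
    finally show "length ((?\<phi> ^^ k) [(x, True)]) \<le> ?N" by (simp add: power_mult)
  qed
  then obtain k' where k': "k' < 48 * 2 ^ ?N" "\<And>w. w \<in> carrier F2 \<Longrightarrow> (?\<phi> ^^ k') w = (?\<phi> ^^ k) w"
    by blast
  have "?\<phi> [^]\<^bsub>G\<^esub> k' = ?\<phi> [^]\<^bsub>G\<^esub> k"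
    by (rule G_eqI) (use g k' gens_in_F2 in \<open>auto simp: pow_G\<close>)
  with k k'(1) show ?thesis by auto
qed

definition symbols :: "sym set" where
  "symbols = insert mark (Inl ` pair_alphabet gs \<union> enc ` ({0, 1} \<times> UNIV))"

lemma decidable_orbit_language:
  assumes L: "\<And>u v. encode_pair u v \<in> L \<longleftrightarrow>
      u \<in> words {..<length gs} \<and> v \<in> words {..<length gs} \<and> P (val u) (val v)"
    and pairs: "\<And>w. w \<in> L \<Longrightarrow> \<exists>u v. w = encode_pair u v"
    and P: "\<And>u v n K. u \<in> words {..<length gs} \<Longrightarrow> v \<in> words {..<length gs} \<Longrightarrow>
      (\<And>l m. length (act l m) \<le> K) \<Longrightarrow> 1 \<le> K \<Longrightarrow> length u + length v \<le> n \<Longrightarrow>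
      P (val u) (val v) \<longleftrightarrow> (\<exists>i < 2 * (48 * 2 ^ ((K ^ 12) ^ n) :: nat).
        val u [^]\<^bsub>G\<^esub> (if both then 48 * 2 ^ ((K ^ 12) ^ n) else 0 :: nat) \<otimes>\<^bsub>G\<^esub> val v = val u [^]\<^bsub>G\<^esub> i)"
  shows "decidable_language (pair_alphabet gs) L"
proof -
  obtain K where K: "1 \<le> K" "\<And>l m. length (act l m) \<le> K" using act_bounded by blast
  have words: "encode_pair u v \<in> lists (pair_alphabet gs) \<longleftrightarrow>
      u \<in> words {..<length gs} \<and> v \<in> words {..<length gs}" for u v
    by (auto simp: encode_pair_def pair_alphabet_def words_def lists_eq_set)
  show ?thesis
  proof (rule decidable_by_com[where S = symbols and b = "Inr 0" and R = 13 and out = r_found])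
    show "L \<subseteq> lists (pair_alphabet gs)"
      using pairs L words by blast
    show "finite symbols" "Inl ` pair_alphabet gs \<subseteq> symbols" "Inr 0 \<notin> symbols"
      by (auto simp: symbols_def pair_alphabet_def enc_def)
    show "wf_com 13 symbols (orbit_program (K ^ 12) both)"
      by (rule wf_orbit_program)
        (use act_in_words in \<open>auto simp: symbols_def pair_alphabet_def inv_letter_def enc_def\<close>)
    fix w assume w: "w \<in> lists (pair_alphabet gs)"
    let ?B = "48 * 2 ^ ((K ^ 12) ^ length w) :: nat"
    let ?k = "if both then ?B else 0"
    have "(\<exists>i<2 * ?B. (app_pair (rev (map inv_letter u)) ^^ i)
        ((app_pair u ^^ ?k) (app_pair v base)) = base) \<longleftrightarrow> w \<in> L"
      if uv: "w = encode_pair u v" for u v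
    proof -
      have u: "u \<in> words {..<length gs}" and v: "v \<in> words {..<length gs}"
        using w words uv by auto
      note closed = val_closed[OF u] val_closed[OF v]
      have "(app_pair (rev (map inv_letter u)) ^^ i) ((app_pair u ^^ ?k) (app_pair v base)) = base \<longleftrightarrow>
          val u [^]\<^bsub>G\<^esub> ?k \<otimes>\<^bsub>G\<^esub> val v = val u [^]\<^bsub>G\<^esub> i" for i
      proof -
        let ?x = "val u [^]\<^bsub>G\<^esub> ?k \<otimes>\<^bsub>G\<^esub> val v"
        have "(app_pair (rev (map inv_letter u)) ^^ i) ((app_pair u ^^ ?k) (app_pair v base)) =
            gen_images (inv\<^bsub>G\<^esub> (val u) [^]\<^bsub>G\<^esub> i \<otimes>\<^bsub>G\<^esub> ?x)"
          using closed val_inverse[OF u] u v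
          by (simp only: base_gen_images app_pair_gen_images app_pair_funpow_gen_images G.one_closed
              G.r_one G.m_closed G.nat_pow_closed)
        then have "(app_pair (rev (map inv_letter u)) ^^ i) ((app_pair u ^^ ?k) (app_pair v base)) = base \<longleftrightarrow>
            inv\<^bsub>G\<^esub> (val u [^]\<^bsub>G\<^esub> i) \<otimes>\<^bsub>G\<^esub> ?x = \<one>\<^bsub>G\<^esub>"
          using closed by (simp only: base_gen_images gen_images_inject G.nat_pow_inv G.one_closed
              G.m_closed G.nat_pow_closed G.inv_closed)
        also have "\<dots> \<longleftrightarrow> ?x = val u [^]\<^bsub>G\<^esub> i \<otimes>\<^bsub>G\<^esub> \<one>\<^bsub>G\<^esub>"
          by (rule G.inv_solve_left') (use closed in simp_all)
        finally show ?thesis using closed by simp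
      qed
      then show ?thesis
        using P[OF u v K(2,1), of "length w"] L[of u v] u v by (simp add: uv encode_pair_def)
    qed
    then show "exec (orbit_program (K ^ 12) both) ((\<lambda>r. [])(0 := map Inl w)) r_found \<noteq> [] \<longleftrightarrow> w \<in> L"
      unfolding exec_orbit_program using pairs by blast
  qed auto
qed

theorem nonneg_power_orbit_decidable_G: "nonneg_power_orbit_decidable G gs"
  unfolding nonneg_power_orbit_decidable_def
proof (rule decidable_orbit_language[where both = False and P = "\<lambda>g h. \<exists>k :: nat. g [^]\<^bsub>G\<^esub> k = h"])
  fix u v and n K :: nat
  assume uv: "u \<in> words {..<length gs}" "v \<in> words {..<length gs}"
    and K: "\<And>l m. length (act l m) \<le> K" "1 \<le> K" and n: "length u + length v \<le> n"
  let ?B = "48 * 2 ^ ((K ^ 12) ^ n) :: nat"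
  have "(\<exists>k :: nat. val u [^]\<^bsub>G\<^esub> k = val v) \<longleftrightarrow> (\<exists>i < 2 * ?B. val u [^]\<^bsub>G\<^esub> i = val v)"
  proof
    assume "\<exists>k :: nat. val u [^]\<^bsub>G\<^esub> k = val v"
    then obtain k where k: "k < ?B" "val u [^]\<^bsub>G\<^esub> k = val v"
      using power_bound_words[OF K uv _ n] by auto
    then have "k < 2 * ?B" by linarith
    with k(2) show "\<exists>i < 2 * ?B. val u [^]\<^bsub>G\<^esub> i = val v" by blast
  qed auto
  then show "(\<exists>k :: nat. val u [^]\<^bsub>G\<^esub> k = val v) \<longleftrightarrow> (\<exists>i < 2 * ?B.
      val u [^]\<^bsub>G\<^esub> (if False then ?B else 0 :: nat) \<otimes>\<^bsub>G\<^esub> val v = val u [^]\<^bsub>G\<^esub> i)"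
    using val_closed[OF uv(2)] by (simp add: eq_commute[of "val v"])
qed (auto simp: nonneg_power_orbit_language_def encode_pair_inject)

lemma int_power_bound:
  assumes uv: "u \<in> words {..<length gs}" "v \<in> words {..<length gs}"
    and K: "\<And>l m. length (act l m) \<le> K" "1 \<le> K" and n: "length u + length v \<le> n"
  defines "B \<equiv> 48 * 2 ^ ((K ^ 12) ^ n) :: nat"
  shows "(\<exists>k :: int. val u [^]\<^bsub>G\<^esub> k = val v) \<longleftrightarrow>
    (\<exists>i < 2 * B. val u [^]\<^bsub>G\<^esub> B \<otimes>\<^bsub>G\<^esub> val v = val u [^]\<^bsub>G\<^esub> i)"
proof -
  let ?g = "val u"
  have g: "?g \<in> carrier G" "val v \<in> carrier G" using uv by (auto simp: val_closed)
  have shift: "?g [^]\<^bsub>G\<^esub> B \<otimes>\<^bsub>G\<^esub> val v = ?g [^]\<^bsub>G\<^esub> i \<longleftrightarrow> ?g [^]\<^bsub>G\<^esub> (int i - int B) = val v" for i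
  proof
    assume "?g [^]\<^bsub>G\<^esub> B \<otimes>\<^bsub>G\<^esub> val v = ?g [^]\<^bsub>G\<^esub> i"
    then have "inv\<^bsub>G\<^esub> (?g [^]\<^bsub>G\<^esub> B) \<otimes>\<^bsub>G\<^esub> ?g [^]\<^bsub>G\<^esub> i = val v"
      using g by (metis G.inv_solve_left G.m_closed G.nat_pow_closed)
    moreover have "?g [^]\<^bsub>G\<^esub> (- int B + int i) = ?g [^]\<^bsub>G\<^esub> (- int B) \<otimes>\<^bsub>G\<^esub> ?g [^]\<^bsub>G\<^esub> int i"
      by (rule G.int_pow_mult[OF g(1)])
    ultimately show "?g [^]\<^bsub>G\<^esub> (int i - int B) = val v"
      using g by (simp add: G.int_pow_neg int_pow_int)
  next
    assume "?g [^]\<^bsub>G\<^esub> (int i - int B) = val v"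
    moreover have "?g [^]\<^bsub>G\<^esub> (int B + (int i - int B)) = ?g [^]\<^bsub>G\<^esub> int B \<otimes>\<^bsub>G\<^esub> ?g [^]\<^bsub>G\<^esub> (int i - int B)"
      by (rule G.int_pow_mult[OF g(1)])
    ultimately show "?g [^]\<^bsub>G\<^esub> B \<otimes>\<^bsub>G\<^esub> val v = ?g [^]\<^bsub>G\<^esub> i"
      by (simp add: int_pow_int)
  qed
  have "\<exists>i < 2 * B. ?g [^]\<^bsub>G\<^esub> (int i - int B) = val v" if k: "?g [^]\<^bsub>G\<^esub> k = val v" for k :: int
  proof (cases "k \<ge> 0")
    case True
    then obtain m where "k = int m" using nonneg_int_cases by blast
    then obtain k' where "k' < B" "?g [^]\<^bsub>G\<^esub> k' = val v"
      using power_bound_words[OF K uv _ n, of m] k by (auto simp: B_def int_pow_int)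
    then show ?thesis by (intro exI[of _ "k' + B"]) (simp add: int_pow_int)
  next
    case False
    define m where "m = nat (- k)"
    have m: "k = - int m" using False by (simp add: m_def)
    let ?u' = "rev (map inv_letter u)"
    have "val ?u' [^]\<^bsub>G\<^esub> m = val v"
      using k g by (simp add: m val_inverse[OF uv(1)] G.int_pow_neg int_pow_int G.nat_pow_inv)
    then obtain k' where k': "k' < B" "val ?u' [^]\<^bsub>G\<^esub> k' = val v"
      using power_bound_words[OF K val_inverse(1)[OF uv(1)] uv(2), of m n] n by (auto simp: B_def)
    then have "?g [^]\<^bsub>G\<^esub> (- int k') = val v"
      using g by (simp add: val_inverse[OF uv(1)] G.int_pow_neg int_pow_int G.nat_pow_inv)
    then show ?thesis using k'(1) by (intro exI[of _ "B - k'"]) simp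
  qed
  then show ?thesis by (auto simp: shift)
qed

theorem power_orbit_decidable_G: "power_orbit_decidable G gs"
  unfolding power_orbit_decidable_def
proof (rule decidable_orbit_language[where both = True and P = "\<lambda>g h. \<exists>k :: int. g [^]\<^bsub>G\<^esub> k = h"])
  fix u v and n K :: nat
  assume "u \<in> words {..<length gs}" "v \<in> words {..<length gs}"
    "\<And>l m. length (act l m) \<le> K" "1 \<le> K" "length u + length v \<le> n"
  from int_power_bound[OF this]
  show "(\<exists>k :: int. val u [^]\<^bsub>G\<^esub> k = val v) \<longleftrightarrow>
      (\<exists>i < 2 * (48 * 2 ^ ((K ^ 12) ^ n) :: nat).
        val u [^]\<^bsub>G\<^esub> (if True then 48 * 2 ^ ((K ^ 12) ^ n) else 0 :: nat) \<otimes>\<^bsub>G\<^esub> val v = val u [^]\<^bsub>G\<^esub> i)"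
    by (simp only: if_True)
qed (auto simp: power_orbit_language_def encode_pair_inject)

end

theorem corollary2p5:
  fixes gs :: "(nat letter list \<Rightarrow> nat letter list) list"
  assumes "set gs \<subseteq> carrier (AutoGroup F2)"
    and "generate (AutoGroup F2) (set gs) = carrier (AutoGroup F2)"
  shows "power_orbit_decidable (AutoGroup F2) gs \<and>
         nonneg_power_orbit_decidable (AutoGroup F2) gs"
proof -
  interpret generated_automorphisms gs by unfold_locales (rule assms(1))
  show ?thesis using power_orbit_decidable_G nonneg_power_orbit_decidable_G by blast
qed

end
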